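(* Let $p\geq 3/2$ and let $f:[0,\infty)\to(0,\infty)$ be a continuous, non-increasing function. If $\int_{0}^{\infty} f(x)\,\mathrm{d}x<\infty$, then there exists a constant $C_{p,f}>0$ such that for all Jacobi operators $J$ with $v\in\ell^{p}(\mathbb{Z})$ $$\sum_{\lambda\in\sigma_{\mathrm d}(J)}\frac{\mathrm{dist}(\lambda,[-2,2])^{p}}{|\lambda^{2}-4|^{1/2}}\,f\left(-\log\left(\frac{\mathrm{dist}(\lambda,[-2,2])}{\mathrm{dist}(\lambda,\{-2,2\})}\right)\right)\leq C_{p,f}\,\|v\|^{p}_{\ell^{p}},$$ where $C_{p,f}=C_{p}\left(\int_{0}^{\infty} f(x)\,\mathrm{d}x+f(0)\right)$ for a constant $C_p>0$ depending only on $p$ (not on $f$).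
   Context: Given bounded complex sequences $\{a_n\}_{n\in\mathbb{Z}},\{b_n\}_{n\in\mathbb{Z}},\{c_n\}_{n\in\mathbb{Z}}$, the Jacobi operator $J$ is the bounded operator in $\ell^2(\mathbb{Z})$ given by $(Ju)_n=a_{n-1}u_{n-1}+b_nu_n+c_nu_{n+1}$, $n\in\mathbb{Z}$. Associated with $J$ is the sequence $v=\{v_n\}_{n\in\mathbb{Z}}$, $$v_n:=\max\{|a_{n-1}-1|,|a_n-1|,|b_n|,|c_{n-1}-1|,|c_n-1|\}.$$ If $v_n\to0$ as $|n|\to\infty$, then the essential spectrum of $J$ is $[-2,2]$; $\sigma_{\mathrm d}(J)\subset\mathbb{C}\setminus[-2,2]$ denotes the discrete spectrum (isolated eigenvalues of finite algebraic multiplicity). In sums over $\sigma_{\mathrm d}(J)$ each eigenvalue is repeated according to its algebraic multiplicity. *)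

theory Defs
  imports "HOL-Analysis.Analysis" "HOL-Library.Function_Algebras"
begin

text \<open>Two-sided sequences are functions on \<^typ>\<open>int\<close>; addition and zero are the pointwise ones.\<close>

definition ell :: "real \<Rightarrow> (int \<Rightarrow> 'a::real_normed_vector) set" where
  "ell p = {u. (\<lambda>n. norm (u n) powr p) summable_on UNIV}"

definition ell_norm :: "real \<Rightarrow> (int \<Rightarrow> 'a::real_normed_vector) \<Rightarrow> real" where
  "ell_norm p u = (\<Sum>\<^sub>\<infinity>n. norm (u n) powr p) powr (1 / p)"

definition cscale :: "complex \<Rightarrow> (int \<Rightarrow> complex) \<Rightarrow> (int \<Rightarrow> complex)" where
  "cscale z u = (\<lambda>n. z * u n)"

interpretation cseq: vector_space cscale
  by standard (auto simp: cscale_def fun_eq_iff algebra_simps)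

text \<open>
  Operators in \<open>\<ell>\<^sup>2(\<int>)\<close> are represented by maps on all sequences, of which only the
  restriction to \<^term>\<open>ell 2\<close> matters below.
\<close>

definition shifted :: "((int \<Rightarrow> complex) \<Rightarrow> (int \<Rightarrow> complex)) \<Rightarrow> complex
    \<Rightarrow> (int \<Rightarrow> complex) \<Rightarrow> (int \<Rightarrow> complex)" where
  "shifted T z u = T u - cscale z u"

text \<open>The norm inequality says that the inverse of the bijection \<open>T - z\<close> is bounded.\<close>

definition resolvent_set :: "((int \<Rightarrow> complex) \<Rightarrow> (int \<Rightarrow> complex)) \<Rightarrow> complex set" where
  "resolvent_set T = {z. bij_betw (shifted T z) (ell 2) (ell 2) \<and>
     (\<exists>K. \<forall>u\<in>ell 2. ell_norm 2 u \<le> K * ell_norm 2 (shifted T z u))}"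

definition spectrum :: "((int \<Rightarrow> complex) \<Rightarrow> (int \<Rightarrow> complex)) \<Rightarrow> complex set" where
  "spectrum T = - resolvent_set T"

definition eigenvalue :: "((int \<Rightarrow> complex) \<Rightarrow> (int \<Rightarrow> complex)) \<Rightarrow> complex \<Rightarrow> bool" where
  "eigenvalue T z \<longleftrightarrow> (\<exists>u\<in>ell 2. u \<noteq> 0 \<and> T u = cscale z u)"

definition root_space ::
    "((int \<Rightarrow> complex) \<Rightarrow> (int \<Rightarrow> complex)) \<Rightarrow> complex \<Rightarrow> (int \<Rightarrow> complex) set" where
  "root_space T z = {u \<in> ell 2. \<exists>k. (shifted T z ^^ k) u = 0}"

text \<open>
  The algebraic multiplicity is the complex dimension of the root space. As \<^term>\<open>cseq.dim\<close>
  has the value 0 on infinite-dimensional spaces, finiteness is a separate predicate.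
  At isolated points of the spectrum outside the essential spectrum this dimension is the rank
  of the Riesz projection.
\<close>

definition finite_alg_mult :: "((int \<Rightarrow> complex) \<Rightarrow> (int \<Rightarrow> complex)) \<Rightarrow> complex \<Rightarrow> bool" where
  "finite_alg_mult T z \<longleftrightarrow> (\<exists>B. finite B \<and> root_space T z \<subseteq> cseq.span B)"

definition alg_mult :: "((int \<Rightarrow> complex) \<Rightarrow> (int \<Rightarrow> complex)) \<Rightarrow> complex \<Rightarrow> nat" where
  "alg_mult T z = cseq.dim (root_space T z)"

definition discrete_spectrum :: "((int \<Rightarrow> complex) \<Rightarrow> (int \<Rightarrow> complex)) \<Rightarrow> complex set" where
  "discrete_spectrum T =
     {z. z isolated_in spectrum T \<and> eigenvalue T z \<and> finite_alg_mult T z}"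

definition jacobi :: "(int \<Rightarrow> complex) \<Rightarrow> (int \<Rightarrow> complex) \<Rightarrow> (int \<Rightarrow> complex)
    \<Rightarrow> (int \<Rightarrow> complex) \<Rightarrow> (int \<Rightarrow> complex)" where
  "jacobi a b c u = (\<lambda>n. a (n - 1) * u (n - 1) + b n * u n + c n * u (n + 1))"

definition jacobi_v ::
    "(int \<Rightarrow> complex) \<Rightarrow> (int \<Rightarrow> complex) \<Rightarrow> (int \<Rightarrow> complex) \<Rightarrow> int \<Rightarrow> real" where
  "jacobi_v a b c n =
     Max {cmod (a (n - 1) - 1), cmod (a n - 1), cmod (b n), cmod (c (n - 1) - 1), cmod (c n - 1)}"

text \<open>
  Both distances below are positive if \<open>z\<close> is not in \<open>[-2,2]\<close>, and then \<open>d \<le> e\<close>,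
  so that the argument of \<open>f\<close> is nonnegative.
\<close>

definition LT_term :: "real \<Rightarrow> (real \<Rightarrow> real) \<Rightarrow> complex \<Rightarrow> real" where
  "LT_term p f z =
     (let d = infdist z (complex_of_real ` {-2..2}); e = infdist z {-2, 2}
      in d powr p / cmod (z\<^sup>2 - 4) powr (1 / 2) * f (- ln (d / e)))"

end

theory Submission
  imports Defs
begin

text \<open>
  Write \<open>v\<close> for \<^term>\<open>jacobi_v a b c\<close>, \<open>J\<close> for the Jacobi operator, \<open>d\<close> and \<open>r\<close> for the distances
  of \<open>\<lambda>\<close> to \<open>[-2,2]\<close> and to \<open>{-2,2}\<close>, and \<open>\<gamma> = p - 1/2 \<ge> 1\<close>.

  The sum over the discrete spectrum is reduced to quadratic forms. Triangularising \<open>J\<close> on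
  finitely many root spaces (lemma \<open>exists_schur_family\<close>) gives an orthonormal set \<open>E\<close> in
  which each of these eigenvalues occurs among the numbers \<open>\<langle>J e, e\<rangle>\<close> at least as often as
  its algebraic multiplicity. For real \<open>\<tau>\<close>, \<open>Re ((1 - \<i> \<tau>) \<langle>(J - 2) e, e\<rangle>)\<close> is at most
  \<open>\<Sum>n. V n \<bar>e n\<bar>\<^sup>2 - \<parallel>D e\<parallel>\<^sup>2\<close> with the diagonal potential \<open>V = 3 (1 + \<bar>\<tau>\<bar>) v\<close>
  (\<open>jacobi_form_le\<close>), where \<open>D\<close> is the forward difference.

  For such forms a Lieb--Thirring inequality holds on every orthonormal set: the \<open>\<gamma>\<close>-th powers of
  the positive values sum up to at most a constant times \<open>\<Sum>n. V n powr (\<gamma> + 1/2)\<close>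
  (\<open>lieb_thirring_orthonormal\<close>). For \<open>\<gamma> = 1\<close> this follows from the kinetic energy inequality
  \<open>\<Sum>n. \<rho> n ^ 3 \<le> \<Sum>e\<in>E. \<parallel>D e\<parallel>\<^sup>2\<close> for the density \<open>\<rho> n = \<Sum>e\<in>E. \<bar>e n\<bar>\<^sup>2\<close> (\<open>eden_foias\<close>),
  since \<open>V \<rho> \<le> \<rho> ^ 3 + V powr (3/2)\<close>; for \<open>\<gamma> > 1\<close> one applies the case \<open>\<gamma> = 1\<close> to \<open>V - t\<close>
  and sums over dyadic \<open>t\<close>.

  Points of the right half-plane, outside \<open>[-2,2]\<close> and with \<open>d \<ge> s r\<close>, lie deep inside one of
  the half-planes \<open>Re \<lambda> - 2 + \<tau> Im \<lambda> > 0\<close> with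
  \<open>\<tau> = \<plusminus>1\<close> or \<open>\<tau> = \<plusminus>2/s\<close>. Hence the sum of \<open>d powr \<gamma>\<close> over these points is at most a constant
  times \<open>s powr (-1/2) \<Sum>n. v n powr p\<close> (\<open>sector_sum_le\<close>). The summand in question is at most
  \<open>d powr \<gamma> (d/r) powr (1/2) f (- ln (d/r))\<close>, so the points with \<open>k \<le> - ln (d/r) < k + 1\<close> contribute
  at most a constant times \<open>f k\<close>, and the sum of all \<open>f k\<close> is at most \<open>f 0 + \<integral> f\<close>. The left
  half-plane is treated by the unitary equivalence of \<open>-J\<close> to the Jacobi operator with \<open>b\<close>
  replaced by \<open>-b\<close>.
\<close>

section \<open>The inner product on square-summable sequences\<close>

text \<open>
  The inner product of \<open>\<ell>\<^sup>2(\<int>)\<close>, linear in the first argument, and the squared norm. Both are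
  defined for all sequences and are meaningful on \<^term>\<open>ell 2\<close> only, since a divergent
  \<^const>\<open>infsum\<close> has the value 0.
\<close>

definition ip :: "(int \<Rightarrow> complex) \<Rightarrow> (int \<Rightarrow> complex) \<Rightarrow> complex" where
  "ip u w = (\<Sum>\<^sub>\<infinity>n. u n * cnj (w n))"

definition sqn :: "(int \<Rightarrow> complex) \<Rightarrow> real" where
  "sqn u = (\<Sum>\<^sub>\<infinity>n. (cmod (u n))\<^sup>2)"

lemma ell2_iff: "u \<in> ell 2 \<longleftrightarrow> (\<lambda>n. (cmod (u n))\<^sup>2) summable_on UNIV"
  by (simp add: ell_def)

lemma ell2D: "u \<in> ell 2 \<Longrightarrow> (\<lambda>n. (cmod (u n))\<^sup>2) summable_on UNIV"
  by (simp add: ell2_iff)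

lemma sqn_nonneg [simp]: "0 \<le> sqn u"
  unfolding sqn_def by (intro infsum_nonneg) auto

lemma ell2_dominated:
  assumes "u \<in> ell 2" and "\<And>n. cmod (w n) \<le> K * cmod (u n)"
  shows "w \<in> ell 2"
proof -
  have "(\<lambda>n. K\<^sup>2 * (cmod (u n))\<^sup>2) summable_on UNIV"
    using ell2D[OF assms(1)] by (rule summable_on_cmult_right)
  then show ?thesis
    unfolding ell2_iff
  proof (rule summable_on_comparison_test)
    fix n
    show "(cmod (w n))\<^sup>2 \<le> K\<^sup>2 * (cmod (u n))\<^sup>2"
      using power_mono[OF assms(2)[of n], of 2] by (simp add: power_mult_distrib)
  qed auto
qed

lemma ell2_cscale: "u \<in> ell 2 \<Longrightarrow> cscale z u \<in> ell 2"
  by (rule ell2_dominated[where K = "cmod z"]) (auto simp: cscale_def norm_mult)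

lemma ell2_add:
  fixes u w :: "int \<Rightarrow> complex"
  assumes "u \<in> ell 2" "w \<in> ell 2"
  shows "u + w \<in> ell 2"
  unfolding ell2_iff
proof (rule summable_on_comparison_test)
  show "(\<lambda>n. 2 * ((cmod (u n))\<^sup>2 + (cmod (w n))\<^sup>2)) summable_on UNIV"
    by (intro summable_on_cmult_right summable_on_add ell2D assms)
  fix n
  have "(cmod ((u + w) n))\<^sup>2 \<le> (cmod (u n) + cmod (w n))\<^sup>2"
    by (intro power_mono) (auto simp: norm_triangle_ineq)
  also have "\<dots> \<le> 2 * ((cmod (u n))\<^sup>2 + (cmod (w n))\<^sup>2)"
    using sum_squares_bound[of "cmod (u n)" "cmod (w n)"] by (simp add: power2_sum)
  finally show "(cmod ((u + w) n))\<^sup>2 \<le> 2 * ((cmod (u n))\<^sup>2 + (cmod (w n))\<^sup>2)" .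
qed auto

lemma subspace_ell2: "cseq.subspace (ell 2)"
  by (rule cseq.subspaceI) (auto simp: ell2_add ell2_cscale, auto simp: ell2_iff)

lemma ell2_diff: "(u :: int \<Rightarrow> complex) \<in> ell 2 \<Longrightarrow> w \<in> ell 2 \<Longrightarrow> u - w \<in> ell 2"
  by (rule cseq.subspace_diff[OF subspace_ell2])

lemma bij_shift: "bij_betw (\<lambda>n::int. n + k) UNIV UNIV"
  by (rule bij_betw_byWitness[where f' = "\<lambda>n. n - k"]) auto

lemma infsum_shift: "(\<Sum>\<^sub>\<infinity>n::int. g (n + k)) = (\<Sum>\<^sub>\<infinity>n. g n)"
  by (rule infsum_reindex_bij_betw[OF bij_shift])

lemma summable_shift: "(\<lambda>n::int. g (n + k)) summable_on UNIV \<longleftrightarrow> g summable_on UNIV"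
  by (rule summable_on_reindex_bij_betw[OF bij_shift])

lemma ell2_shift: "(u :: int \<Rightarrow> complex) \<in> ell 2 \<Longrightarrow> (\<lambda>n. u (n + k)) \<in> ell 2"
  unfolding ell2_iff by (subst summable_shift[of "\<lambda>n. (cmod (u n))\<^sup>2"])

lemma ip_summable:
  assumes "u \<in> ell 2" "w \<in> ell 2"
  shows "(\<lambda>n. u n * cnj (w n)) summable_on UNIV"
proof (rule abs_summable_summable, rule summable_on_comparison_test)
  show "(\<lambda>n. (cmod (u n))\<^sup>2 + (cmod (w n))\<^sup>2) summable_on UNIV"
    by (intro summable_on_add ell2D assms)
  fix n
  have "0 \<le> cmod (u n) * cmod (w n)"
    by simp
  then show "norm (u n * cnj (w n)) \<le> (cmod (u n))\<^sup>2 + (cmod (w n))\<^sup>2"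
    using sum_squares_bound[of "cmod (u n)" "cmod (w n)"] unfolding norm_mult complex_mod_cnj
    by linarith
qed auto

lemma ip_has_sum:
  "u \<in> ell 2 \<Longrightarrow> w \<in> ell 2 \<Longrightarrow> ((\<lambda>n. u n * cnj (w n)) has_sum ip u w) UNIV"
  unfolding ip_def by (rule has_sum_infsum[OF ip_summable])

lemma sqn_has_sum: "u \<in> ell 2 \<Longrightarrow> ((\<lambda>n. (cmod (u n))\<^sup>2) has_sum sqn u) UNIV"
  unfolding sqn_def by (rule has_sum_infsum[OF ell2D])

lemma ip_add_left:
  "u \<in> ell 2 \<Longrightarrow> u' \<in> ell 2 \<Longrightarrow> w \<in> ell 2 \<Longrightarrow> ip (u + u') w = ip u w + ip u' w"
  unfolding ip_def by (simp add: ring_distribs infsum_add[OF ip_summable ip_summable])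

lemma ip_cscale_left: "ip (cscale z u) w = z * ip u w"
  unfolding ip_def cscale_def by (simp add: mult.assoc infsum_cmult_right')

lemma ip_commute: "ip w u = cnj (ip u w)"
  unfolding ip_def by (subst infsum_cnj[symmetric]) (simp add: mult.commute)

lemma ip_diff_left:
  assumes "u \<in> ell 2" "u' \<in> ell 2" "w \<in> ell 2"
  shows "ip (u - u') w = ip u w - ip u' w"
  using ip_add_left[of "u - u'" u' w] assms ell2_diff by simp

lemma ip_zero_left [simp]: "ip 0 w = 0"
  by (simp add: ip_def)

lemma ip_sum_left:
  assumes "finite A" "\<And>x. x \<in> A \<Longrightarrow> g x \<in> ell 2" "w \<in> ell 2"
  shows "ip (\<Sum>x\<in>A. g x) w = (\<Sum>x\<in>A. ip (g x) w)"
  using assms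
proof (induction A)
  case (insert x A)
  have "sum g A \<in> ell 2"
    using insert by (intro cseq.subspace_sum[OF subspace_ell2]) auto
  then have "ip (g x + sum g A) w = ip (g x) w + (\<Sum>x\<in>A. ip (g x) w)"
    using insert by (subst ip_add_left) auto
  then show ?case
    by (simp only: sum.insert[OF insert.hyps])
qed simp

lemma ip_self: "u \<in> ell 2 \<Longrightarrow> ip u u = of_real (sqn u)"
  using has_sum_of_real[OF sqn_has_sum, of u, where ?'a = complex]
  by (intro has_sum_unique[OF ip_has_sum]) (auto simp: complex_norm_square[symmetric])

lemma sqn_eq_0_iff:
  assumes "u \<in> ell 2"
  shows "sqn u = 0 \<longleftrightarrow> u = 0"
proof
  assume "sqn u = 0"
  then have "(cmod (u n))\<^sup>2 = 0" for n
    using nonneg_infsum_le_0D[of "\<lambda>n. (cmod (u n))\<^sup>2" UNIV n] ell2D[OF assms]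
    by (simp add: sqn_def)
  then show "u = 0"
    by (auto simp: fun_eq_iff)
qed (simp add: sqn_def)

text \<open>Orthonormal subsets of \<open>\<ell>\<^sup>2(\<int>)\<close>; only finite ones are considered.\<close>

definition orthonormal :: "(int \<Rightarrow> complex) set \<Rightarrow> bool" where
  "orthonormal E \<longleftrightarrow> finite E \<and> E \<subseteq> ell 2 \<and>
     (\<forall>e\<in>E. \<forall>e'\<in>E. ip e e' = (if e = e' then 1 else 0))"

lemma orthonormal_subset: "orthonormal E \<Longrightarrow> F \<subseteq> E \<Longrightarrow> orthonormal F"
  unfolding orthonormal_def by (meson finite_subset subset_iff)

lemma orthonormal_sqn: "orthonormal E \<Longrightarrow> e \<in> E \<Longrightarrow> sqn e = 1"
  using ip_self[of e] by (auto simp: orthonormal_def)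

lemma span_orthonormal_ell2: "orthonormal E \<Longrightarrow> cseq.span E \<subseteq> ell 2"
  unfolding orthonormal_def by (intro cseq.span_minimal subspace_ell2) auto

lemma ip_span_zero:
  assumes "orthonormal E" "w \<in> ell 2" "\<And>e. e \<in> E \<Longrightarrow> ip e w = 0" "x \<in> cseq.span E"
  shows "ip x w = 0"
proof -
  have "cseq.subspace {x \<in> ell 2. ip x w = 0}"
    by (rule cseq.subspaceI) (use assms(2) subspace_ell2 in
      \<open>auto simp: ell2_add ell2_cscale ip_add_left ip_cscale_left cseq.subspace_0\<close>)
  then have "cseq.span E \<subseteq> {x \<in> ell 2. ip x w = 0}"
    using assms(1,3) by (intro cseq.span_minimal) (auto simp: orthonormal_def)
  with assms(4) show ?thesis by auto
qed

text \<open>One step of the Gram--Schmidt process.\<close>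

lemma gram_schmidt_step:
  assumes E: "orthonormal E" and u: "u \<in> ell 2" "u \<notin> cseq.span E"
  obtains e c where "e \<notin> cseq.span E" "orthonormal (insert e E)" "u - cscale c e \<in> cseq.span E"
    "c \<noteq> 0"
proof -
  define P where "P = (\<Sum>e\<in>E. cscale (ip u e) e)"
  define w where "w = u - P"
  have fin: "finite E" and sub: "E \<subseteq> ell 2"
    and on: "\<And>e e'. e \<in> E \<Longrightarrow> e' \<in> E \<Longrightarrow> ip e e' = (if e = e' then 1 else 0)"
    using E by (auto simp: orthonormal_def)
  have P: "P \<in> cseq.span E"
    unfolding P_def by (intro cseq.span_sum cseq.span_scale cseq.span_base)
  then have P2: "P \<in> ell 2"
    using span_orthonormal_ell2[OF E] by auto
  have w2: "w \<in> ell 2"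
    unfolding w_def using u P2 by (intro ell2_diff)
  have ipw: "ip w e = 0" if "e \<in> E" for e
  proof -
    have "ip P e = (\<Sum>e'\<in>E. ip (cscale (ip u e') e') e)"
      unfolding P_def using fin sub that by (intro ip_sum_left) (auto intro!: ell2_cscale)
    also have "\<dots> = (\<Sum>e'\<in>E. if e' = e then ip u e else 0)"
      by (intro sum.cong) (auto simp: ip_cscale_left on that)
    also have "\<dots> = ip u e"
      using fin that by simp
    finally show ?thesis
      unfolding w_def using u P2 sub that by (subst ip_diff_left) auto
  qed
  have wnot: "w \<notin> cseq.span E"
  proof
    assume "w \<in> cseq.span E"
    then have "w + P \<in> cseq.span E"
      using P by (rule cseq.span_add)
    with u(2) show False by (simp add: w_def)
  qed
  have "w \<noteq> 0"
    using wnot cseq.span_zero by auto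
  then have s0: "sqn w > 0"
    using sqn_eq_0_iff[OF w2] sqn_nonneg[of w] by linarith
  define c where "c = complex_of_real (sqrt (sqn w))"
  have c0: "c \<noteq> 0" and cc: "cnj c = c" and c2: "c * c = of_real (sqn w)"
    using s0 by (auto simp: c_def simp flip: of_real_mult)
  define e where "e = cscale (inverse c) w"
  have we: "w = cscale c e"
    using c0 by (simp add: e_def cscale_def fun_eq_iff)
  have e2: "e \<in> ell 2"
    unfolding e_def by (rule ell2_cscale[OF w2])
  have e_not: "e \<notin> cseq.span E"
    using wnot cseq.span_scale[of e E c] we by auto
  have ipe: "ip e x = 0" "ip x e = 0" if "x \<in> E" for x
    using ipw[OF that] by (simp_all add: e_def ip_cscale_left ip_commute[of x])
  have "ip e e = inverse c * cnj (inverse c) * ip w w"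
    by (simp add: e_def ip_cscale_left ip_commute[of w "cscale _ w"])
      (simp add: ip_commute[of w w, symmetric])
  also have "\<dots> = 1"
    using c0 by (simp add: ip_self[OF w2] cc c2[symmetric] divide_simps)
  finally have ee: "ip e e = 1" .
  have "orthonormal (insert e E)"
    using fin sub e2 ee ipe on e_not cseq.span_base[of e E] unfolding orthonormal_def
    by (smt (verit) finite_insert insert_iff subset_iff)
  moreover have "u - cscale c e \<in> cseq.span E"
    using P by (simp add: we[symmetric] w_def)
  ultimately show ?thesis
    using that e_not c0 by blast
qed

lemma has_sum_finite_sum:
  fixes g :: "'a \<Rightarrow> 'b \<Rightarrow> 'c::topological_comm_monoid_add"
  assumes "\<And>i. i \<in> A \<Longrightarrow> (g i has_sum s i) B"
  shows "((\<lambda>x. \<Sum>i\<in>A. g i x) has_sum (\<Sum>i\<in>A. s i)) B"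
  using assms by (induction A rule: infinite_finite_induct) (auto intro!: has_sum_add)

section \<open>Triangularisation on root spaces\<close>

text \<open>
  The arguments below are about vectors; rewriting with the pointwise operations would expand
  iterates of an operator into abstractions over \<^typ>\<open>int\<close>.
\<close>

declare plus_fun_apply [simp del] zero_fun_apply [simp del] minus_apply [simp del]

lemma span_cscale_cancel:
  assumes "cscale c y \<in> cseq.span E" "c \<noteq> 0"
  shows "y \<in> cseq.span E"
  using cseq.span_scale[OF assms(1), of "inverse c"] assms(2) by simp

text \<open>
  Linear operators that map \<open>\<ell>\<^sup>2(\<int>)\<close> into itself. Linearity is required on all sequences;
  boundedness is not needed.
\<close>

locale ell2_operator =
  fixes T :: "(int \<Rightarrow> complex) \<Rightarrow> (int \<Rightarrow> complex)"
  assumes T_add: "T (u + w) = T u + T w"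
    and T_cscale: "T (cscale z u) = cscale z (T u)"
    and T_ell2: "u \<in> ell 2 \<Longrightarrow> T u \<in> ell 2"
begin

lemma shifted_add: "shifted T z (u + w) = shifted T z u + shifted T z w"
  by (simp add: shifted_def T_add cseq.scale_right_distrib)

lemma shifted_cscale: "shifted T z (cscale y u) = cscale y (shifted T z u)"
  by (simp add: shifted_def T_cscale cseq.scale_right_diff_distrib mult.commute)

lemma shifted_ell2: "u \<in> ell 2 \<Longrightarrow> shifted T z u \<in> ell 2"
  unfolding shifted_def by (intro ell2_diff T_ell2 ell2_cscale)

lemma shifted_zero: "shifted T z 0 = 0"
  using shifted_cscale[of z 0 0] by simp

lemma pow_shifted_add: "(shifted T z ^^ k) (u + w) = (shifted T z ^^ k) u + (shifted T z ^^ k) w"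
  by (induction k) (simp_all add: shifted_add)

lemma pow_shifted_cscale: "(shifted T z ^^ k) (cscale y u) = cscale y ((shifted T z ^^ k) u)"
  by (induction k) (simp_all add: shifted_cscale)

lemma pow_shifted_ell2: "u \<in> ell 2 \<Longrightarrow> (shifted T z ^^ k) u \<in> ell 2"
  by (induction k) (simp_all add: shifted_ell2)

lemma pow_shifted_zero: "(shifted T z ^^ k) 0 = 0"
  by (induction k) (simp_all add: shifted_zero)

lemma pow_shifted_zero_mono:
  assumes "(shifted T z ^^ k) u = 0" "k \<le> m"
  shows "(shifted T z ^^ m) u = 0"
proof -
  have "(shifted T z ^^ m) u = (shifted T z ^^ (m - k)) ((shifted T z ^^ k) u)"
    using funpow_add[of "m - k" k "shifted T z"] assms(2) by simp
  then show ?thesis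
    using assms(1) pow_shifted_zero by simp
qed

lemma subspace_root_space: "cseq.subspace (root_space T z)"
proof (rule cseq.subspaceI)
  show "0 \<in> root_space T z"
    using cseq.subspace_0[OF subspace_ell2] by (auto simp: root_space_def pow_shifted_zero)
next
  fix u w assume "u \<in> root_space T z" "w \<in> root_space T z"
  then obtain k l where "(shifted T z ^^ k) u = 0" "(shifted T z ^^ l) w = 0"
    and uw: "u \<in> ell 2" "w \<in> ell 2"
    by (auto simp: root_space_def)
  then have "(shifted T z ^^ max k l) (u + w) = 0"
    using pow_shifted_zero_mono[of k z u "max k l"] pow_shifted_zero_mono[of l z w "max k l"]
    by (simp add: pow_shifted_add)
  then show "u + w \<in> root_space T z"
    using uw ell2_add by (auto simp: root_space_def)
next
  fix c u assume "u \<in> root_space T z"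
  then show "cscale c u \<in> root_space T z"
    by (auto simp: root_space_def ell2_cscale pow_shifted_cscale intro!: exI)
qed

text \<open>
  A Schur family is a finite orthonormal set with \<open>T\<close>-invariant span. Each of its elements \<open>e\<close>
  accounts for one unit of the multiplicity of the value \<open>\<langle>T e, e\<rangle>\<close>: the part of a
  root space inside the span is at most as large as the number of elements with that value.
\<close>

definition schur_family :: "(int \<Rightarrow> complex) set \<Rightarrow> bool" where
  "schur_family E \<longleftrightarrow> orthonormal E \<and> (\<forall>x\<in>cseq.span E. T x \<in> cseq.span E) \<and>
     (\<forall>z. \<exists>B. finite B \<and> card B \<le> card {e\<in>E. ip (T e) e = z} \<and>
        cseq.span E \<inter> root_space T z \<subseteq> cseq.span B)"

text \<open>
  As long as the multiplicity of \<open>z\<close> is not used up, the root space is not contained in the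
  span. The last iterate of \<open>T - z\<close> outside the span, orthonormalised, is the new element; it
  is mapped by \<open>T - z\<close> into the old span, so that the matrix of \<open>T\<close> stays triangular.
\<close>

lemma schur_family_extend:
  assumes E: "schur_family E" and less: "card {e\<in>E. ip (T e) e = z} < alg_mult T z"
  obtains e where "e \<notin> E" "schur_family (insert e E)" "ip (T e) e = z"
proof -
  have on: "orthonormal E" and inv: "\<And>x. x \<in> cseq.span E \<Longrightarrow> T x \<in> cseq.span E"
    using E by (auto simp: schur_family_def)
  have cover: "\<exists>B. finite B \<and> card B \<le> card {e\<in>E. ip (T e) e = y} \<and>
      cseq.span E \<inter> root_space T y \<subseteq> cseq.span B" for y
    using E by (auto simp: schur_family_def)
  have finE: "finite E"
    using on by (simp add: orthonormal_def)
  have sinv: "shifted T y x \<in> cseq.span E" if "x \<in> cseq.span E" for x y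
    unfolding shifted_def using that by (intro cseq.span_diff cseq.span_scale inv)
  \<comment> \<open>Otherwise the multiplicity would be at most the number of elements with value \<open>z\<close>.\<close>
  have "\<not> root_space T z \<subseteq> cseq.span E"
  proof
    assume "root_space T z \<subseteq> cseq.span E"
    then obtain B where "finite B" "card B \<le> card {e\<in>E. ip (T e) e = z}"
      "root_space T z \<subseteq> cseq.span B"
      using cover[of z] by auto
    then show False
      using cseq.dim_le_card[of "root_space T z" B] less by (simp add: alg_mult_def)
  qed
  then obtain x k0 where x: "x \<in> ell 2" "x \<notin> cseq.span E" and k0: "(shifted T z ^^ k0) x = 0"
    by (auto simp: root_space_def)
  define k where "k = (LEAST k. (shifted T z ^^ k) x \<in> cseq.span E)"
  have k: "(shifted T z ^^ k) x \<in> cseq.span E"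
    unfolding k_def by (rule LeastI[of _ k0]) (simp add: k0 cseq.span_zero)
  then obtain m where m: "k = Suc m"
    using x(2) by (cases k) auto
  define u where "u = (shifted T z ^^ m) x"
  have u: "u \<in> ell 2" "u \<notin> cseq.span E" "shifted T z u \<in> cseq.span E"
    using not_less_Least[of m "\<lambda>k. (shifted T z ^^ k) x \<in> cseq.span E"] m k pow_shifted_ell2[OF x(1)]
    by (auto simp: u_def k_def)
  obtain e c where e: "e \<notin> cseq.span E" "orthonormal (insert e E)"
    and c: "u - cscale c e \<in> cseq.span E" "c \<noteq> 0"
    by (rule gram_schmidt_step[OF on u(1,2)])
  have e2: "e \<in> ell 2" and ee: "ip e e = 1"
    using e(2) by (auto simp: orthonormal_def)
  have eE: "e \<notin> E"
    using e(1) cseq.span_base by auto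
  have "shifted T z u = shifted T z (u - cscale c e) + cscale c (shifted T z e)"
    by (simp flip: shifted_cscale shifted_add)
  then have "cscale c (shifted T z e) = shifted T z u - shifted T z (u - cscale c e)"
    by simp
  then have "cscale c (shifted T z e) \<in> cseq.span E"
    using u(3) sinv[OF c(1)] cseq.span_diff by metis
  then have Se: "shifted T z e \<in> cseq.span E"
    using c(2) by (rule span_cscale_cancel)
  have Te: "T e = shifted T z e + cscale z e"
    by (simp add: shifted_def)
  have orth: "ip y e = 0" if "y \<in> cseq.span E" for y
    by (rule ip_span_zero[OF on e2 _ that]) (use e(2) eE in \<open>auto simp: orthonormal_def\<close>)
  have qe: "ip (T e) e = z"
    unfolding Te using e2 ee orth[OF Se]
    by (simp add: ip_add_left[OF shifted_ell2[OF e2] ell2_cscale[OF e2] e2] ip_cscale_left)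
  have sub: "cseq.span E \<subseteq> cseq.span (insert e E)"
    by (intro cseq.span_mono) auto
  have inv': "T y \<in> cseq.span (insert e E)" if y: "y \<in> cseq.span (insert e E)" for y
  proof -
    obtain l where l: "y - cscale l e \<in> cseq.span E"
      using y by (auto simp: cseq.span_breakdown_eq)
    have "T y = T (y - cscale l e) + cscale l (T e)"
      by (simp flip: T_add T_cscale)
    moreover have "T e \<in> cseq.span (insert e E)"
      unfolding Te using subsetD[OF sub Se]
      by (rule cseq.span_add) (intro cseq.span_scale cseq.span_base insertI1)
    ultimately show ?thesis
      using inv[OF l] sub cseq.span_add cseq.span_scale by (metis subsetD)
  qed
  have cover': "\<exists>B. finite B \<and> card B \<le> card {e'\<in>insert e E. ip (T e') e' = y} \<and>
      cseq.span (insert e E) \<inter> root_space T y \<subseteq> cseq.span B" for y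
  proof (cases "y = z")
    case False
    obtain B where B: "finite B" "card B \<le> card {e\<in>E. ip (T e) e = y}"
      "cseq.span E \<inter> root_space T y \<subseteq> cseq.span B"
      using cover[of y] by auto
    \<comment> \<open>Modulo the old span, \<open>T - y\<close> acts on \<open>e\<close> as the nonzero factor \<open>z - y\<close>, so no new
      vector of the root space of \<open>y\<close> arises.\<close>
    have "w \<in> cseq.span E" if w: "w \<in> cseq.span (insert e E)" "w \<in> root_space T y" for w
    proof -
      obtain l where l: "w - cscale l e \<in> cseq.span E"
        using w(1) by (auto simp: cseq.span_breakdown_eq)
      obtain j where j: "(shifted T y ^^ j) w = 0"
        using w(2) by (auto simp: root_space_def)
      have "(shifted T y ^^ i) w - cscale ((z - y) ^ i * l) e \<in> cseq.span E" for i
      proof (induction i)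
        case 0
        then show ?case using l by (simp only: funpow_0 power_0 mult_1)
      next
        case (Suc i)
        let ?v = "(shifted T y ^^ i) w" and ?d = "(z - y) ^ i * l"
        have "shifted T y ?v = shifted T y (?v - cscale ?d e) + cscale ?d (shifted T y e)"
          by (simp flip: shifted_cscale shifted_add)
        also have "shifted T y e = shifted T z e + cscale (z - y) e"
          by (simp add: shifted_def cseq.scale_left_diff_distrib)
        finally have "shifted T y ?v - cscale ((z - y) * ?d) e
            = shifted T y (?v - cscale ?d e) + cscale ?d (shifted T z e)"
          by (simp add: cseq.scale_right_distrib mult.commute)
        then show ?case
          using cseq.span_add[OF sinv[OF Suc.IH, of y] cseq.span_scale[OF Se, of ?d]]
          by (simp only: funpow.simps o_apply power_Suc mult.assoc)
      qed
      from this[of j] have "cscale (- ((z - y) ^ j * l)) e \<in> cseq.span E"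
        by (simp add: j)
      then have "l = 0"
        using e(1) False span_cscale_cancel[of "- ((z - y) ^ j * l)" e E] by auto
      then show ?thesis using l by simp
    qed
    moreover have "{e'\<in>insert e E. ip (T e') e' = y} = {e'\<in>E. ip (T e') e' = y}"
      using qe False by auto
    ultimately show ?thesis
      using B by (intro exI[of _ B]) auto
  next
    case True
    obtain B where B: "finite B" "card B \<le> card {e\<in>E. ip (T e) e = z}"
      "cseq.span E \<inter> root_space T z \<subseteq> cseq.span B"
      using cover[of z] by auto
    have "{e'\<in>insert e E. ip (T e') e' = z} = insert e {e'\<in>E. ip (T e') e' = z}"
      using qe by auto
    then have card: "card {e'\<in>insert e E. ip (T e') e' = z} = Suc (card {e'\<in>E. ip (T e') e' = z})"
      using finE eE by simp
    show ?thesis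
    proof (cases "cseq.span (insert e E) \<inter> root_space T z \<subseteq> cseq.span E")
      case True
      then show ?thesis
        using B card \<open>y = z\<close> by (intro exI[of _ B]) auto
    next
      case False
      then obtain x0 where x0: "x0 \<in> root_space T z" "x0 \<notin> cseq.span E"
        and "x0 \<in> cseq.span (insert e E)"
        by auto
      then obtain l0 where l0: "x0 - cscale l0 e \<in> cseq.span E"
        by (auto simp: cseq.span_breakdown_eq)
      have "l0 \<noteq> 0"
        using x0(2) l0 by auto
      \<comment> \<open>The span has codimension one, so a single new vector \<open>x0\<close> of the root space suffices.\<close>
      have "w \<in> cseq.span (insert x0 B)"
        if w: "w \<in> cseq.span (insert e E)" "w \<in> root_space T z" for w
      proof -
        obtain l where l: "w - cscale l e \<in> cseq.span E"
          using w(1) by (auto simp: cseq.span_breakdown_eq)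
        have "w - cscale (l / l0) x0 = (w - cscale l e) - cscale (l / l0) (x0 - cscale l0 e)"
          using \<open>l0 \<noteq> 0\<close> by (simp add: cseq.scale_right_diff_distrib)
        then have "w - cscale (l / l0) x0 \<in> cseq.span E"
          using cseq.span_diff[OF l cseq.span_scale[OF l0, of "l / l0"]] by (simp only:)
        moreover have "w - cscale (l / l0) x0 \<in> root_space T z"
          by (intro cseq.subspace_diff[OF subspace_root_space]
              cseq.subspace_scale[OF subspace_root_space] w x0)
        ultimately show ?thesis
          using B(3) by (auto simp: cseq.span_breakdown_eq)
      qed
      moreover have "card (insert x0 B) \<le> Suc (card B)"
        by (rule card_insert_le_m1) auto
      ultimately show ?thesis
        using B card \<open>y = z\<close> by (intro exI[of _ "insert x0 B"]) auto
    qed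
  qed
  have "schur_family (insert e E)"
    using e(2) inv' cover' by (simp add: schur_family_def)
  with eE qe that show ?thesis by blast
qed

lemma schur_family_empty: "schur_family {}"
  by (auto simp: schur_family_def orthonormal_def shifted_def[symmetric] intro!: exI[of _ "{}"])
    (use T_cscale[of 0 0] in simp)

text \<open>
  An inequality suffices in the conclusion, because the summands of the final estimate are
  nonnegative. Infinite-dimensional root spaces are harmless, as \<^const>\<open>alg_mult\<close> is then 0.
\<close>

lemma exists_schur_family:
  assumes "finite F"
  obtains E where "orthonormal E" "\<And>z. z \<in> F \<Longrightarrow> alg_mult T z \<le> card {e\<in>E. ip (T e) e = z}"
proof -
  have "\<exists>E'. schur_family E' \<and> (\<forall>z\<in>F. alg_mult T z \<le> card {e\<in>E'. ip (T e) e = z})"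
    if "schur_family E" for E
    using that
  proof (induction "\<Sum>z\<in>F. alg_mult T z - card {e\<in>E. ip (T e) e = z}" arbitrary: E
      rule: less_induct)
    case less
    show ?case
    proof (cases "\<forall>z\<in>F. alg_mult T z \<le> card {e\<in>E. ip (T e) e = z}")
      case False
      then obtain z where z: "z \<in> F" "card {e\<in>E. ip (T e) e = z} < alg_mult T z"
        by auto
      obtain e where e: "e \<notin> E" "schur_family (insert e E)" "ip (T e) e = z"
        by (rule schur_family_extend[OF less.prems z(2)])
      have fin: "finite E"
        using less.prems by (simp add: schur_family_def orthonormal_def)
      have mono: "card {e\<in>E. ip (T e) e = y} \<le> card {e'\<in>insert e E. ip (T e') e' = y}" for y
        using fin by (intro card_mono) auto
      have "{e'\<in>insert e E. ip (T e') e' = z} = insert e {e'\<in>E. ip (T e') e' = z}"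
        using e by auto
      then have "card {e'\<in>insert e E. ip (T e') e' = z} = Suc (card {e'\<in>E. ip (T e') e' = z})"
        using fin e by simp
      then have "(\<Sum>z\<in>F. alg_mult T z - card {e'\<in>insert e E. ip (T e') e' = z})
          < (\<Sum>z\<in>F. alg_mult T z - card {e\<in>E. ip (T e) e = z})"
        using z mono assms by (intro sum_strict_mono_ex1) (auto intro!: diff_le_mono2 bexI[of _ z])
      then show ?thesis
        using less.hyps e(2) by blast
    qed (use less.prems in blast)
  qed
  from this[OF schur_family_empty] that show ?thesis
    by (auto simp: schur_family_def)
qed

end

declare plus_fun_apply [simp] zero_fun_apply [simp] minus_apply [simp]

section \<open>A Lieb--Thirring inequality for orthonormal sets\<close>

text \<open>The forward difference operator \<open>D\<close>; \<open>-D\<^sup>*D\<close> is the free Jacobi operator minus 2.\<close>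

definition fdiff :: "(int \<Rightarrow> complex) \<Rightarrow> (int \<Rightarrow> complex)" where
  "fdiff u = (\<lambda>n. u (n + 1) - u n)"

lemma fdiff_ell2: "u \<in> ell 2 \<Longrightarrow> fdiff u \<in> ell 2"
  using ell2_diff[OF ell2_shift[of u 1], of u] by (simp add: fdiff_def fun_diff_def)

lemma fdiff_sum: "fdiff (\<Sum>x\<in>A. cscale (c x) (g x)) = (\<Sum>x\<in>A. cscale (c x) (fdiff (g x)))"
  by (induction A rule: infinite_finite_induct)
    (auto simp: fdiff_def cscale_def fun_eq_iff algebra_simps)

text \<open>
  Agmon's inequality \<open>\<bar>u n\<bar>\<^sup>2 \<le> \<parallel>u\<parallel> \<parallel>D u\<parallel>\<close>, in the equivalent form with a free parameter
  \<open>t\<close>. The value \<open>\<bar>u n\<bar>\<^sup>2\<close> is a telescoping sum from either side.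
\<close>

lemma agmon:
  assumes u: "u \<in> ell 2" and t: "t > 0"
  shows "2 * (cmod (u n))\<^sup>2 \<le> t * sqn u + sqn (fdiff u) / t"
proof -
  define g where "g = (\<lambda>k. (cmod (u k))\<^sup>2)"
  have g: "g summable_on A" for A
    using ell2D[OF u] summable_on_subset_banach[of g UNIV A] by (simp add: g_def)
  have "bij_betw (\<lambda>k::int. k + 1) {n..} {n+1..}"
    by (rule bij_betw_byWitness[where f' = "\<lambda>k. k - 1"]) auto
  then have 1: "((\<lambda>k. g (k + 1)) has_sum infsum g {n+1..}) {n..}"
    using has_sum_reindex_bij_betw[of "\<lambda>k. k + 1" "{n..}" "{n+1..}" g] g by simp
  have "bij_betw (\<lambda>k::int. k + 1) {..<n} {..n}"
    by (rule bij_betw_byWitness[where f' = "\<lambda>k. k - 1"]) auto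
  then have 2: "((\<lambda>k. g (k + 1)) has_sum infsum g {..n}) {..<n}"
    using has_sum_reindex_bij_betw[of "\<lambda>k. k + 1" "{..<n}" "{..n}" g] g by simp
  have "{n..} = insert n {n+1..}" "{..n} = insert n {..<n}"
    by auto
  then have ins: "infsum g {n..} = g n + infsum g {n+1..}" "infsum g {..n} = g n + infsum g {..<n}"
    using infsum_insert[OF g, of n "{n+1..}"] infsum_insert[OF g, of n "{..<n}"] by auto
  define f where "f = (\<lambda>k. if k < n then g (k + 1) - g k else g k - g (k + 1))"
  have "((\<lambda>k. g k - g (k + 1)) has_sum g n) {n..}"
    using has_sum_add[OF has_sum_infsum[OF g] has_sum_uminusI[OF 1]] ins by simp
  then have "(f has_sum g n) {n..}"
    by (rule has_sum_cong[THEN iffD1, rotated]) (auto simp: f_def)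
  moreover have "((\<lambda>k. g (k + 1) - g k) has_sum g n) {..<n}"
    using has_sum_add[OF 2 has_sum_uminusI[OF has_sum_infsum[OF g]]] ins by simp
  then have "(f has_sum g n) {..<n}"
    by (rule has_sum_cong[THEN iffD1, rotated]) (auto simp: f_def)
  ultimately have "(f has_sum (g n + g n)) ({n..} \<union> {..<n})"
    by (intro has_sum_Un_disjoint) auto
  moreover have "{n..} \<union> {..<n} = UNIV"
    by auto
  ultimately have f: "(f has_sum (g n + g n)) UNIV"
    by simp
  have g1: "((\<lambda>k. g (k + 1)) has_sum sqn u) UNIV"
    using has_sum_reindex_bij_betw[OF bij_shift[of 1], of g "sqn u"] sqn_has_sum[OF u]
    by (simp add: g_def)
  have h: "((\<lambda>k. (cmod (fdiff u k))\<^sup>2 / t + t / 2 * (g k + g (k + 1)))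
      has_sum (sqn (fdiff u) / t + t / 2 * (sqn u + sqn u))) UNIV"
    by (intro has_sum_add has_sum_divide_const has_sum_cmult_right sqn_has_sum fdiff_ell2 u g1)
      (use sqn_has_sum[OF u] in \<open>simp add: g_def\<close>)
  have le: "f k \<le> (cmod (fdiff u k))\<^sup>2 / t + t / 2 * (g k + g (k + 1))" for k
  proof -
    define x y d where "x = cmod (u (k + 1))" and "y = cmod (u k)" and "d = cmod (fdiff u k)"
    have d: "\<bar>x - y\<bar> \<le> d" "x \<ge> 0" "y \<ge> 0"
      using norm_triangle_ineq3[of "u (k + 1)" "u k"] by (auto simp: x_def y_def d_def fdiff_def)
    have "f k \<le> \<bar>x\<^sup>2 - y\<^sup>2\<bar>"
      by (auto simp: f_def g_def x_def y_def)
    also have "\<dots> = \<bar>x - y\<bar> * (x + y)"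
      using d by (simp add: power2_eq_square square_diff_square_factored abs_mult mult.commute)
    also have "\<dots> \<le> d * (x + y)"
      using d by (intro mult_right_mono) auto
    also have "\<dots> \<le> d\<^sup>2 / t + t / 2 * (y\<^sup>2 + x\<^sup>2)"
    proof -
      have "0 \<le> (d - t * x)\<^sup>2 + (d - t * y)\<^sup>2"
        by simp
      then have "2 * t * (d * (x + y)) \<le> 2 * d\<^sup>2 + t\<^sup>2 * (y\<^sup>2 + x\<^sup>2)"
        by (simp add: power2_diff power_mult_distrib algebra_simps)
      then show ?thesis
        using t by (simp add: field_simps power2_eq_square)
    qed
    finally show ?thesis
      by (simp add: g_def x_def y_def d_def)
  qed
  show ?thesis
    using has_sum_mono[OF f h le] by (simp add: g_def)
qed

lemma ip_lincomb:
  assumes "finite A" "\<And>x. x \<in> A \<Longrightarrow> g x \<in> ell 2"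
  shows "ip (\<Sum>x\<in>A. cscale (c x) (g x)) (\<Sum>x\<in>A. cscale (c x) (g x))
    = (\<Sum>x\<in>A. \<Sum>y\<in>A. c x * cnj (c y) * ip (g x) (g y))"
proof -
  let ?s = "\<Sum>x\<in>A. cscale (c x) (g x)"
  have s: "?s \<in> ell 2"
    using assms by (intro cseq.subspace_sum[OF subspace_ell2] ell2_cscale)
  have r: "ip w ?s = (\<Sum>y\<in>A. cnj (c y) * ip w (g y))" if "w \<in> ell 2" for w
    using assms that
    by (simp add: ip_commute[of w "sum _ _"] ip_sum_left ell2_cscale ip_cscale_left)
      (simp add: ip_commute[of w])
  have "ip ?s ?s = (\<Sum>x\<in>A. ip (cscale (c x) (g x)) ?s)"
    using assms s by (intro ip_sum_left ell2_cscale)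
  also have "\<dots> = (\<Sum>x\<in>A. c x * (\<Sum>y\<in>A. cnj (c y) * ip (g x) (g y)))"
    using assms r by (intro sum.cong) (auto simp: ip_cscale_left)
  finally show ?thesis
    by (simp add: sum_distrib_left mult.assoc)
qed

text \<open>
  The kinetic energy inequality, by the argument of Eden and Foias: Agmon's inequality is
  applied, for each \<open>n\<close>, to the linear combination \<open>u\<close> of the orthonormal set whose
  coefficients are the conjugates of the values at \<open>n\<close>. Then \<open>u n = \<parallel>u\<parallel>\<^sup>2 = \<rho> n\<close>, and
  orthonormality makes the sum of \<open>\<parallel>D u\<parallel>\<^sup>2\<close> over all \<open>n\<close> collapse.
\<close>

lemma eden_foias:
  assumes E: "orthonormal E"
  defines "\<rho> \<equiv> \<lambda>n. \<Sum>e\<in>E. (cmod (e n))\<^sup>2"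
  shows "(\<lambda>n. \<rho> n ^ 3) summable_on UNIV" "(\<Sum>\<^sub>\<infinity>n. \<rho> n ^ 3) \<le> (\<Sum>e\<in>E. sqn (fdiff e))"
proof -
  have fin: "finite E" and sub: "\<And>e. e \<in> E \<Longrightarrow> e \<in> ell 2"
    and on: "\<And>e e'. e \<in> E \<Longrightarrow> e' \<in> E \<Longrightarrow> ip e e' = (if e = e' then 1 else 0)"
    using E by (auto simp: orthonormal_def)
  define G where
    "G = (\<lambda>n. \<Sum>e\<in>E. \<Sum>e'\<in>E. e' n * cnj (e n) * ip (fdiff e) (fdiff e'))"
  have "(G has_sum (\<Sum>e\<in>E. \<Sum>e'\<in>E. ip e' e * ip (fdiff e) (fdiff e'))) UNIV"
    unfolding G_def by (intro has_sum_finite_sum has_sum_cmult_left ip_has_sum sub)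
  also have "(\<Sum>e\<in>E. \<Sum>e'\<in>E. ip e' e * ip (fdiff e) (fdiff e'))
      = (\<Sum>e\<in>E. \<Sum>e'\<in>E. if e' = e then ip (fdiff e) (fdiff e) else 0)"
    by (intro sum.cong refl) (auto simp: on)
  also have "\<dots> = of_real (\<Sum>e\<in>E. sqn (fdiff e))"
    using fin by (simp add: ip_self fdiff_ell2 sub)
  finally have "(G has_sum of_real (\<Sum>e\<in>E. sqn (fdiff e))) UNIV" .
  then have G: "((\<lambda>n. Re (G n)) has_sum (\<Sum>e\<in>E. sqn (fdiff e))) UNIV"
    using has_sum_Re by fastforce
  have \<rho>0: "\<rho> n \<ge> 0" for n
    by (auto simp: \<rho>_def intro!: sum_nonneg)
  have le: "\<rho> n ^ 3 \<le> Re (G n)" for n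
  proof -
    define u where "u = (\<Sum>e\<in>E. cscale (cnj (e n)) e)"
    have u2: "u \<in> ell 2"
      unfolding u_def by (intro cseq.subspace_sum[OF subspace_ell2] ell2_cscale sub)
    have "u m = (\<Sum>e\<in>E. cnj (e n) * e m)" for m
      unfolding u_def by (induction E rule: infinite_finite_induct) (auto simp: cscale_def)
    then have un: "u n = of_real (\<rho> n)"
      by (simp add: \<rho>_def complex_norm_square mult.commute del: of_real_power)
    have "ip u u = (\<Sum>e\<in>E. \<Sum>e'\<in>E. cnj (e n) * cnj (cnj (e' n)) * ip e e')"
      unfolding u_def using fin sub by (rule ip_lincomb)
    also have "\<dots> = (\<Sum>e\<in>E. \<Sum>e'\<in>E. if e' = e then e n * cnj (e n) else 0)"
      by (intro sum.cong refl) (auto simp: on)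
    also have "\<dots> = of_real (\<rho> n)"
      using fin by (simp add: \<rho>_def complex_norm_square del: of_real_power)
    finally have "complex_of_real (sqn u) = of_real (\<rho> n)"
      by (simp add: ip_self[OF u2])
    then have su: "sqn u = \<rho> n"
      by (simp only: of_real_eq_iff)
    have "ip (fdiff u) (fdiff u) = G n"
      unfolding u_def fdiff_sum G_def using fin sub
      by (subst ip_lincomb) (auto intro!: sum.cong fdiff_ell2)
    then have sd: "sqn (fdiff u) = Re (G n)"
      by (metis Re_complex_of_real fdiff_ell2 ip_self u2)
    show ?thesis
    proof (cases "\<rho> n = 0")
      case True
      then show ?thesis
        using sqn_nonneg[of "fdiff u"] by (simp add: sd)
    next
      case False
      then have pos: "\<rho> n > 0"
        using \<rho>0[of n] by simp
      \<comment> \<open>Agmon's inequality with \<open>t = \<rho> n\<close>\<close>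
      have "2 * (\<rho> n)\<^sup>2 \<le> \<rho> n * \<rho> n + Re (G n) / \<rho> n"
        using agmon[OF u2 pos, of n] by (simp add: un su sd)
      then have "(\<rho> n)\<^sup>2 \<le> Re (G n) / \<rho> n"
        by (simp add: power2_eq_square)
      then show ?thesis
        using pos by (simp add: field_simps power2_eq_square power3_eq_cube)
    qed
  qed
  show s: "(\<lambda>n. \<rho> n ^ 3) summable_on UNIV"
    by (rule summable_on_comparison_test[OF has_sum_imp_summable[OF G]]) (use le \<rho>0 in auto)
  show "(\<Sum>\<^sub>\<infinity>n. \<rho> n ^ 3) \<le> (\<Sum>e\<in>E. sqn (fdiff e))"
    by (rule has_sum_mono[OF has_sum_infsum[OF s] G]) (rule le)
qed

text \<open>
  The negative of the quadratic form of the discrete Schroedinger operator \<open>D\<^sup>*D - V\<close>;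
  on an orthonormal set its positive values play the role of the absolute values of the
  negative eigenvalues.
\<close>

definition schr_form :: "(int \<Rightarrow> real) \<Rightarrow> (int \<Rightarrow> complex) \<Rightarrow> real" where
  "schr_form V e = (\<Sum>\<^sub>\<infinity>n. V n * (cmod (e n))\<^sup>2) - sqn (fdiff e)"

lemma potential_le:
  fixes r w :: real
  assumes "r \<ge> 0" "w \<ge> 0"
  shows "w * r \<le> r ^ 3 + w powr (3/2)"
proof (cases "w \<le> r\<^sup>2")
  case True
  then have "w * r \<le> r\<^sup>2 * r"
    using assms by (intro mult_right_mono) auto
  then show ?thesis
    by (simp add: power2_eq_square power3_eq_cube add_increasing2)
next
  case False
  then have "r \<le> sqrt w"
    using assms by (intro real_le_rsqrt) auto
  then have "w * r \<le> w * sqrt w"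
    using assms by (intro mult_left_mono) auto
  also have "w * sqrt w = w powr (3/2)"
    using assms powr_add[of w 1 "1/2"] by (simp add: powr_half_sqrt)
  finally show ?thesis
    using assms by (simp add: add_increasing)
qed

lemma lieb_thirring_first_moment:
  assumes E: "orthonormal E" and W: "\<And>n. W n \<ge> 0" "(\<lambda>n. W n powr (3/2)) summable_on UNIV"
  shows "(\<Sum>e\<in>E. schr_form W e) \<le> (\<Sum>\<^sub>\<infinity>n. W n powr (3/2))"
proof -
  define \<rho> where "\<rho> = (\<lambda>n. \<Sum>e\<in>E. (cmod (e n))\<^sup>2)"
  have fin: "finite E"
    using E by (simp add: orthonormal_def)
  have \<rho>0: "\<rho> n \<ge> 0" for n
    by (auto simp: \<rho>_def intro!: sum_nonneg)
  have ef: "(\<lambda>n. \<rho> n ^ 3) summable_on UNIV" "(\<Sum>\<^sub>\<infinity>n. \<rho> n ^ 3) \<le> (\<Sum>e\<in>E. sqn (fdiff e))"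
    unfolding \<rho>_def by (rule eden_foias[OF E])+
  have sum: "(\<lambda>n. \<rho> n ^ 3 + W n powr (3/2)) summable_on UNIV"
    by (intro summable_on_add ef W)
  have le: "W n * \<rho> n \<le> \<rho> n ^ 3 + W n powr (3/2)" for n
    by (rule potential_le[OF \<rho>0 W(1)])
  have s\<rho>: "(\<lambda>n. W n * \<rho> n) summable_on UNIV"
    by (rule summable_on_comparison_test[OF sum le]) (use \<rho>0 W in auto)
  have "(\<lambda>n. W n * (cmod (e n))\<^sup>2) summable_on UNIV" if "e \<in> E" for e
  proof (rule summable_on_comparison_test[OF s\<rho>])
    fix n
    show "W n * (cmod (e n))\<^sup>2 \<le> W n * \<rho> n"
      unfolding \<rho>_def using that fin W(1)[of n]
      by (intro mult_left_mono member_le_sum) auto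
  qed (use W in auto)
  then have "((\<lambda>n. \<Sum>e\<in>E. W n * (cmod (e n))\<^sup>2)
      has_sum (\<Sum>e\<in>E. \<Sum>\<^sub>\<infinity>n. W n * (cmod (e n))\<^sup>2)) UNIV"
    by (intro has_sum_finite_sum has_sum_infsum)
  then have "((\<lambda>n. W n * \<rho> n) has_sum (\<Sum>e\<in>E. \<Sum>\<^sub>\<infinity>n. W n * (cmod (e n))\<^sup>2)) UNIV"
    by (simp add: \<rho>_def sum_distrib_left)
  from has_sum_mono[OF this has_sum_infsum[OF sum] le]
  have "(\<Sum>e\<in>E. \<Sum>\<^sub>\<infinity>n. W n * (cmod (e n))\<^sup>2) \<le> (\<Sum>\<^sub>\<infinity>n. \<rho> n ^ 3 + W n powr (3/2))" .
  also have "\<dots> = (\<Sum>\<^sub>\<infinity>n. \<rho> n ^ 3) + (\<Sum>\<^sub>\<infinity>n. W n powr (3/2))"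
    by (intro infsum_add ef W)
  finally show ?thesis
    using ef(2) by (simp add: schr_form_def sum_subtractf)
qed

text \<open>
  On unit vectors, subtracting \<open>t\<close> from the form is the same as subtracting it from \<open>V\<close>. The
  first moment bound applies to the vectors whose form exceeds \<open>t\<close>.
\<close>

lemma lieb_thirring_threshold:
  assumes E: "orthonormal E" and t: "t \<ge> 0"
    and V: "\<And>e. e \<in> E \<Longrightarrow> (\<lambda>n. V n * (cmod (e n))\<^sup>2) summable_on UNIV"
    and W: "(\<lambda>n. max 0 (V n - t) powr (3/2)) summable_on UNIV" 
  shows "(\<Sum>e\<in>E. max 0 (schr_form V e - t)) \<le> (\<Sum>\<^sub>\<infinity>n. max 0 (V n - t) powr (3/2))"
proof -
  define F where "F = {e\<in>E. schr_form V e > t}"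
  have F: "orthonormal F"
    using E by (rule orthonormal_subset) (auto simp: F_def)
  have le: "schr_form V e - t \<le> schr_form (\<lambda>n. max 0 (V n - t)) e" if "e \<in> F" for e
  proof -
    have e: "e \<in> E" "e \<in> ell 2" "sqn e = 1"
      using that E orthonormal_sqn by (auto simp: F_def orthonormal_def)
    have h: "((\<lambda>n. V n * (cmod (e n))\<^sup>2 - t * (cmod (e n))\<^sup>2)
        has_sum ((\<Sum>\<^sub>\<infinity>n. V n * (cmod (e n))\<^sup>2) + - (t * 1))) UNIV"
      unfolding diff_conv_add_uminus e(3)[symmetric]
      by (intro has_sum_add has_sum_uminusI has_sum_cmult_right has_sum_infsum V e sqn_has_sum)
    have "(\<lambda>n. max 0 (V n - t) * (cmod (e n))\<^sup>2) summable_on UNIV"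
    proof -
      have "(\<lambda>n. \<bar>V n * (cmod (e n))\<^sup>2\<bar>) summable_on UNIV"
        using V[OF e(1)] summable_on_iff_abs_summable_on_real[of "\<lambda>n. V n * (cmod (e n))\<^sup>2"] by simp
      then show ?thesis
      proof (rule summable_on_comparison_test)
        fix n
        have "max 0 (V n - t) \<le> \<bar>V n\<bar>"
          using t by auto
        then show "max 0 (V n - t) * (cmod (e n))\<^sup>2 \<le> \<bar>V n * (cmod (e n))\<^sup>2\<bar>"
          by (simp add: abs_mult mult_right_mono)
      qed auto
    qed
    from has_sum_mono[OF h has_sum_infsum[OF this]]
    have "(\<Sum>\<^sub>\<infinity>n. V n * (cmod (e n))\<^sup>2) - t \<le> (\<Sum>\<^sub>\<infinity>n. max 0 (V n - t) * (cmod (e n))\<^sup>2)"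
      by (simp add: left_diff_distrib[symmetric] mult_right_mono)
    then show ?thesis
      by (simp add: schr_form_def)
  qed
  have "finite E"
    using E by (simp add: orthonormal_def)
  then have "(\<Sum>e\<in>E. max 0 (schr_form V e - t)) = (\<Sum>e\<in>F. schr_form V e - t)"
    by (intro sum.mono_neutral_cong_right) (auto simp: F_def)
  also have "\<dots> \<le> (\<Sum>e\<in>F. schr_form (\<lambda>n. max 0 (V n - t)) e)"
    by (intro sum_mono le)
  also have "\<dots> \<le> (\<Sum>\<^sub>\<infinity>n. max 0 (V n - t) powr (3/2))"
    by (rule lieb_thirring_first_moment[OF F _ W]) simp
  finally show ?thesis .
qed

lemma powr_summable_bounded:
  fixes V :: "int \<Rightarrow> real"
  assumes "\<And>n. V n \<ge> 0" "(\<lambda>n. V n powr p) summable_on UNIV" "p > 0"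
  obtains M where "\<And>n. V n \<le> M"
proof -
  define S where "S = (\<Sum>\<^sub>\<infinity>n. V n powr p)"
  have "V n \<le> S powr (1 / p)" for n
  proof -
    have "V n powr p \<le> S"
      using finite_sum_le_infsum[OF assms(2), of "{n}"] by (simp add: S_def)
    then have "(V n powr p) powr (1 / p) \<le> S powr (1 / p)"
      using assms(3) by (intro powr_mono2) auto
    then show ?thesis
      using assms(1)[of n] assms(3) by (simp add: powr_powr)
  qed
  then show ?thesis using that by blast
qed

lemma summable_bounded_mult:
  fixes V :: "int \<Rightarrow> real"
  assumes "\<And>n. V n \<ge> 0" "\<And>n. V n \<le> M" "e \<in> ell 2"
  shows "(\<lambda>n. V n * (cmod (e n))\<^sup>2) summable_on UNIV"
proof (rule summable_on_comparison_test)
  show "(\<lambda>n. M * (cmod (e n))\<^sup>2) summable_on UNIV"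
    by (intro summable_on_cmult_right ell2D assms)
qed (use assms in \<open>auto intro: mult_right_mono\<close>)

lemma sum_powers_int_le:
  fixes q :: real and K :: "int set"
  assumes "0 < q" "q < 1" "finite K" "\<And>k. k \<in> K \<Longrightarrow> k \<le> m"
  shows "(\<Sum>k\<in>K. q ^ nat (m - k)) \<le> 1 / (1 - q)"
proof -
  have "inj_on (\<lambda>k. nat (m - k)) K"
    using assms(4) by (auto simp: inj_on_def eq_nat_nat_iff)
  then have "(\<Sum>k\<in>K. q ^ nat (m - k)) = (\<Sum>i\<in>(\<lambda>k. nat (m - k)) ` K. q ^ i)"
    by (simp add: sum.reindex)
  also have "\<dots> \<le> (\<Sum>i. q ^ i)"
    using assms by (intro sum_le_suminf summable_geometric) auto
  also have "\<dots> = 1 / (1 - q)"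
    using assms by (intro suminf_geometric) auto
  finally show ?thesis .
qed

lemma dyadic_sum_le:
  fixes x \<delta> :: real and K :: "int set"
  assumes x: "x \<ge> 0" and \<delta>: "\<delta> > 0" and K: "finite K"
  shows "(\<Sum>k\<in>K. 2 powr (k * \<delta>) * max 0 (x - 2 powr k) powr (3/2))
    \<le> x powr (3/2 + \<delta>) / (1 - 2 powr (-\<delta>))"
proof (cases "x = 0")
  case True
  then show ?thesis by (simp add: max_def)
next
  case False
  with x have x: "x > 0" by simp
  define q :: real where "q = 2 powr (-\<delta>)"
  have q: "0 < q" "q < 1"
    using \<delta> powr_less_mono[of "-\<delta>" 0 2] by (auto simp: q_def)
  define m where "m = \<lfloor>log 2 x\<rfloor>"
  define K' where "K' = {k\<in>K. k \<le> m}"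
  have "(\<Sum>k\<in>K. 2 powr (k * \<delta>) * max 0 (x - 2 powr k) powr (3/2))
      = (\<Sum>k\<in>K'. 2 powr (k * \<delta>) * max 0 (x - 2 powr k) powr (3/2))"
  proof (rule sum.mono_neutral_right[OF K])
    show "\<forall>k\<in>K - K'. 2 powr (k * \<delta>) * max 0 (x - 2 powr k) powr (3/2) = 0"
    proof
      fix k assume "k \<in> K - K'"
      then have "\<lfloor>log 2 x\<rfloor> < k"
        by (auto simp: K'_def m_def)
      then have "log 2 x < k"
        by (simp add: floor_less_iff)
      then have "x \<le> 2 powr k"
        using x by (simp add: log_less_iff)
      then show "2 powr (k * \<delta>) * max 0 (x - 2 powr k) powr (3/2) = 0"
        by simp
    qed
  qed (auto simp: K'_def)
  also have "\<dots> \<le> (\<Sum>k\<in>K'. (x powr \<delta> * q ^ nat (m - k)) * x powr (3/2))"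
  proof (intro sum_mono mult_mono)
    fix k assume "k \<in> K'"
    then have k: "k \<le> m" by (simp add: K'_def)
    have "2 powr (k * \<delta>) = (2 powr m) powr \<delta> * q powr (m - k)"
      by (simp add: q_def powr_powr powr_add[symmetric] algebra_simps)
    also have "(2 powr m) powr \<delta> \<le> x powr \<delta>"
      using \<delta> x by (intro powr_mono2) (auto simp: m_def le_log_iff[symmetric])
    also have "q powr (m - k) = q ^ nat (m - k)"
      using q k by (simp add: powr_realpow[symmetric])
    finally show "2 powr (k * \<delta>) \<le> x powr \<delta> * q ^ nat (m - k)"
      using q by (simp add: mult_right_mono)
    show "max 0 (x - 2 powr k) powr (3/2) \<le> x powr (3/2)"
      using x by (intro powr_mono2) auto
  qed (use q in auto)
  also have "\<dots> = x powr (3/2 + \<delta>) * (\<Sum>k\<in>K'. q ^ nat (m - k))"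
    by (simp add: powr_add sum_distrib_left sum_distrib_right mult_ac)
  also have "\<dots> \<le> x powr (3/2 + \<delta>) * (1 / (1 - q))"
    using q K by (intro mult_left_mono sum_powers_int_le) (auto simp: K'_def)
  finally show ?thesis by (simp add: q_def)
qed

text \<open>
  Conversely, a single term suffices for a bound from below, with \<open>2 powr (k + 1) \<le> x\<close> to
  keep \<open>x - 2 powr k\<close> comparable to \<open>x\<close>.
\<close>

lemma dyadic_le:
  fixes x \<delta> :: real
  assumes x: "x > 0" and \<delta>: "\<delta> > 0"
  defines "k \<equiv> \<lfloor>log 2 x\<rfloor> - 1"
  shows "x powr (1 + \<delta>) \<le> 2 * 4 powr \<delta> * (2 powr (k * \<delta>) * max 0 (x - 2 powr k))"
proof -
  have kk: "2 powr (k + 1) \<le> x" "x < 2 powr (k + 2)"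
  proof -
    have "real_of_int k + 1 \<le> log 2 x" "log 2 x < real_of_int k + 2"
      unfolding k_def by linarith+
    then show "2 powr (k + 1) \<le> x" "x < 2 powr (k + 2)"
      using x by (auto simp: le_log_iff log_less_iff)
  qed
  then have k: "2 * 2 powr k \<le> x" "x \<le> 4 * 2 powr k"
    by (auto simp: powr_add)
  have "x powr (1 + \<delta>) = x powr \<delta> * x"
    using x by (simp add: powr_add)
  also have "\<dots> \<le> (4 * 2 powr k) powr \<delta> * (2 * max 0 (x - 2 powr k))"
    using x \<delta> k by (intro mult_mono powr_mono2) auto
  also have "\<dots> = 2 * 4 powr \<delta> * (2 powr (k * \<delta>) * max 0 (x - 2 powr k))"
    by (simp add: powr_mult powr_powr)
  finally show ?thesis .
qed

text \<open>
  Higher moments follow from the first one by summing the inequalities for \<open>V - t\<close> over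
  dyadic \<open>t\<close>, a discrete form of the argument of Aizenman and Lieb. The dyadic series
  diverges at \<open>p = 3/2\<close>, where the first moment inequality is itself the claim.
\<close>

lemma lieb_thirring_orthonormal:
  assumes "p \<ge> 3/2"
  shows "\<exists>K>0. \<forall>E V. orthonormal E \<longrightarrow> (\<forall>n. 0 \<le> V n) \<longrightarrow> (\<lambda>n. V n powr p) summable_on UNIV \<longrightarrow>
    (\<Sum>e\<in>E. max 0 (schr_form V e) powr (p - 1/2)) \<le> K * (\<Sum>\<^sub>\<infinity>n. V n powr p)"
proof (cases "p = 3/2")
  case True
  have "(\<Sum>e\<in>E. max 0 (schr_form V e) powr (p - 1/2)) \<le> 1 * (\<Sum>\<^sub>\<infinity>n. V n powr p)"
    if E: "orthonormal E" and V: "\<forall>n. 0 \<le> V n" "(\<lambda>n. V n powr p) summable_on UNIV" for E V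
  proof -
    obtain M where M: "\<And>n. V n \<le> M"
      using powr_summable_bounded[of V p] V True by auto
    have e2: "e \<in> ell 2" if "e \<in> E" for e
      using E that by (auto simp: orthonormal_def)
    show ?thesis
      using lieb_thirring_threshold[OF E order_refl, of V] V
      by (simp add: summable_bounded_mult[OF _ M e2] max_absorb2 \<open>p = 3/2\<close>)
  qed
  then show ?thesis
    by (intro exI[of _ 1]) auto
next
  case False
  define \<delta> where "\<delta> = p - 3/2"
  have \<delta>: "\<delta> > 0"
    using assms False by (simp add: \<delta>_def)
  define q :: real where "q = 2 powr (-\<delta>)"
  have q: "0 < q" "q < 1"
    using \<delta> powr_less_mono[of "-\<delta>" 0 2] by (auto simp: q_def)
  define C where "C = 2 * 4 powr \<delta>"
  have C: "C > 0" by (simp add: C_def)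
  have "(\<Sum>e\<in>E. max 0 (schr_form V e) powr (p - 1/2)) \<le> C / (1 - q) * (\<Sum>\<^sub>\<infinity>n. V n powr p)"
    if E: "orthonormal E" and V: "\<forall>n. 0 \<le> V n" "(\<lambda>n. V n powr p) summable_on UNIV" for E V
  proof -
    obtain M where M: "\<And>n. V n \<le> M"
      using powr_summable_bounded[of V p] V assms by auto
    have e2: "e \<in> ell 2" if "e \<in> E" for e
      using E that by (auto simp: orthonormal_def)
    have fin: "finite E"
      using E by (simp add: orthonormal_def)
    define h :: "(int \<Rightarrow> complex) \<Rightarrow> int" where "h = (\<lambda>e. \<lfloor>log 2 (schr_form V e)\<rfloor> - 1)"
    define K where "K = h ` E"
    have finK: "finite K"
      using fin by (simp add: K_def)
    have W: "(\<lambda>n. max 0 (V n - t) powr (3/2)) summable_on UNIV" if t: "t > 0" for t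
    proof (rule summable_on_comparison_test)
      show "(\<lambda>n. t powr (3/2 - p) * V n powr p) summable_on UNIV"
        by (intro summable_on_cmult_right V)
      fix n
      show "max 0 (V n - t) powr (3/2) \<le> t powr (3/2 - p) * V n powr p"
      proof (cases "V n > t")
        case True
        have "max 0 (V n - t) powr (3/2) \<le> V n powr (3/2)"
          using True t by (intro powr_mono2) auto
        also have "\<dots> = V n powr (3/2 - p) * V n powr p"
          by (simp flip: powr_add)
        also have "\<dots> \<le> t powr (3/2 - p) * V n powr p"
          using True t assms by (intro mult_right_mono powr_mono2') auto
        finally show ?thesis .
      qed simp
    qed auto
    have "(\<Sum>e\<in>E. max 0 (schr_form V e) powr (p - 1/2))
        \<le> (\<Sum>e\<in>E. C * (\<Sum>k\<in>K. 2 powr (k * \<delta>) * max 0 (schr_form V e - 2 powr k)))"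
    proof (rule sum_mono)
      fix e assume e: "e \<in> E"
      show "max 0 (schr_form V e) powr (p - 1/2)
          \<le> C * (\<Sum>k\<in>K. 2 powr (k * \<delta>) * max 0 (schr_form V e - 2 powr k))"
      proof (cases "schr_form V e > 0")
        case True
        have "max 0 (schr_form V e) powr (p - 1/2) = schr_form V e powr (1 + \<delta>)"
          using True by (simp add: \<delta>_def)
        also have "\<dots> \<le> C * (2 powr (h e * \<delta>) * max 0 (schr_form V e - 2 powr h e))"
          using dyadic_le[OF True \<delta>] by (simp add: C_def h_def)
        also have "\<dots> \<le> C * (\<Sum>k\<in>K. 2 powr (k * \<delta>) * max 0 (schr_form V e - 2 powr k))"
          using e C finK by (intro mult_left_mono member_le_sum) (auto simp: K_def)
        finally show ?thesis .
      next
        case False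
        then show ?thesis
          using C by (auto simp: max_absorb1 intro!: mult_nonneg_nonneg sum_nonneg)
      qed
    qed
    also have "\<dots> = C * (\<Sum>k\<in>K. 2 powr (k * \<delta>) * (\<Sum>e\<in>E. max 0 (schr_form V e - 2 powr k)))"
      by (simp add: sum_distrib_left sum.swap[of _ K E])
    also have "\<dots> \<le> C * (\<Sum>k\<in>K. 2 powr (k * \<delta>) * (\<Sum>\<^sub>\<infinity>n. max 0 (V n - 2 powr k) powr (3/2)))"
    proof (intro mult_left_mono sum_mono)
      fix k
      show "(\<Sum>e\<in>E. max 0 (schr_form V e - 2 powr k)) \<le> (\<Sum>\<^sub>\<infinity>n. max 0 (V n - 2 powr k) powr (3/2))"
        using V(1) by (intro lieb_thirring_threshold E W) (auto intro: summable_bounded_mult[OF _ M e2])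
    qed (use C in auto)
    also have "(\<Sum>k\<in>K. 2 powr (k * \<delta>) * (\<Sum>\<^sub>\<infinity>n. max 0 (V n - 2 powr k) powr (3/2)))
        \<le> (\<Sum>\<^sub>\<infinity>n. V n powr p) / (1 - q)"
    proof (rule has_sum_mono)
      show "((\<lambda>n. \<Sum>k\<in>K. 2 powr (k * \<delta>) * max 0 (V n - 2 powr k) powr (3/2)) has_sum
          (\<Sum>k\<in>K. 2 powr (k * \<delta>) * (\<Sum>\<^sub>\<infinity>n. max 0 (V n - 2 powr k) powr (3/2)))) UNIV"
        by (intro has_sum_finite_sum has_sum_cmult_right has_sum_infsum W) auto
      show "((\<lambda>n. V n powr p / (1 - q)) has_sum ((\<Sum>\<^sub>\<infinity>n. V n powr p) / (1 - q))) UNIV"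
        by (intro has_sum_divide_const has_sum_infsum V)
      fix n
      show "(\<Sum>k\<in>K. 2 powr (k * \<delta>) * max 0 (V n - 2 powr k) powr (3/2)) \<le> V n powr p / (1 - q)"
        using dyadic_sum_le[OF _ \<delta> finK, of "V n"] V(1) by (simp add: q_def \<delta>_def)
    qed
    finally show ?thesis
      using C by (simp add: mult_left_mono)
  qed
  then show ?thesis
    using C q by (intro exI[of _ "C / (1 - q)"]) auto
qed

section \<open>The quadratic form of a Jacobi operator\<close>

lemma jacobi_v_ge:
  "cmod (a (n - 1) - 1) \<le> jacobi_v a b c n" "cmod (a n - 1) \<le> jacobi_v a b c n"
  "cmod (b n) \<le> jacobi_v a b c n"
  "cmod (c (n - 1) - 1) \<le> jacobi_v a b c n" "cmod (c n - 1) \<le> jacobi_v a b c n"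
  by (auto simp: jacobi_v_def intro!: Max_ge)

lemma jacobi_v_nonneg: "0 \<le> jacobi_v a b c n"
  using jacobi_v_ge(3)[of b n a c] norm_ge_zero order_trans by blast

lemma jacobi_ell2:
  assumes "bounded (range a)" "bounded (range b)" "bounded (range c)" "u \<in> ell 2"
  shows "jacobi a b c u \<in> ell 2"
proof -
  obtain A B C where "\<And>n. cmod (a n) \<le> A" "\<And>n. cmod (b n) \<le> B" "\<And>n. cmod (c n) \<le> C"
    using assms(1-3) unfolding bounded_iff by blast
  then have "(\<lambda>n. a (n - 1) * u (n - 1)) \<in> ell 2" "(\<lambda>n. b n * u n) \<in> ell 2"
    "(\<lambda>n. c n * u (n + 1)) \<in> ell 2"
    using ell2_dominated[OF ell2_shift[OF assms(4), of "-1"], of "\<lambda>n. a (n - 1) * u (n - 1)" A]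
      ell2_dominated[OF assms(4), of "\<lambda>n. b n * u n" B]
      ell2_dominated[OF ell2_shift[OF assms(4), of 1], of "\<lambda>n. c n * u (n + 1)" C]
    by (auto simp: norm_mult mult_right_mono)
  then show ?thesis
    using ell2_add[OF ell2_add] by (simp add: jacobi_def plus_fun_def)
qed

lemma ell2_operator_jacobi:
  assumes "bounded (range a)" "bounded (range b)" "bounded (range c)"
  shows "ell2_operator (jacobi a b c)"
  by standard (use jacobi_ell2[OF assms] in
    \<open>auto simp: jacobi_def cscale_def fun_eq_iff algebra_simps\<close>)

lemma ip_free_jacobi:
  assumes e: "e \<in> ell 2"
  shows "ip (\<lambda>n. e (n - 1) + e (n + 1)) e = of_real (2 * sqn e - sqn (fdiff e))"
proof -
  define S where "S = ip (\<lambda>n. e (n + 1)) e"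
  have e1: "(\<lambda>n. e (n + 1)) \<in> ell 2"
    by (rule ell2_shift[OF e])
  have em: "(\<lambda>n. e (n - 1)) \<in> ell 2"
    using ell2_shift[OF e, of "-1"] by simp
  have "ip (\<lambda>n. e (n - 1)) e = ip e (\<lambda>n. e (n + 1))"
    unfolding ip_def using infsum_shift[of "\<lambda>n. e (n - 1) * cnj (e n)" 1] by simp
  then have "ip (\<lambda>n. e (n - 1) + e (n + 1)) e = cnj S + S"
    using ip_add_left[OF em e1 e] by (simp add: S_def ip_commute[of e] plus_fun_def)
  also have "\<dots> = of_real (2 * Re S)"
    by (simp add: complex_eq_iff)
  finally have 1: "ip (\<lambda>n. e (n - 1) + e (n + 1)) e = of_real (2 * Re S)" .
  have s1: "((\<lambda>n. (cmod (e (n + 1)))\<^sup>2) has_sum sqn e) UNIV"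
    using has_sum_reindex_bij_betw[OF bij_shift[of 1], of "\<lambda>n. (cmod (e n))\<^sup>2" "sqn e"]
      sqn_has_sum[OF e] by simp
  have "((\<lambda>n. (cmod (e (n + 1)))\<^sup>2 + (cmod (e n))\<^sup>2 + - (2 * Re (e (n + 1) * cnj (e n))))
      has_sum (sqn e + sqn e + - (2 * Re S))) UNIV"
    unfolding S_def
    by (intro has_sum_add has_sum_uminusI has_sum_cmult_right has_sum_Re ip_has_sum s1
        sqn_has_sum e e1)
  moreover have "(cmod (e (n + 1)))\<^sup>2 + (cmod (e n))\<^sup>2 + - (2 * Re (e (n + 1) * cnj (e n)))
      = (cmod (fdiff e n))\<^sup>2" for n
    unfolding fdiff_def cmod_power2 by (simp add: power2_eq_square algebra_simps)
  ultimately have "((\<lambda>n. (cmod (fdiff e n))\<^sup>2) has_sum (sqn e + sqn e + - (2 * Re S))) UNIV"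
    by simp
  from has_sum_unique[OF this sqn_has_sum[OF fdiff_ell2[OF e]]]
  have "2 * Re S = 2 * sqn e - sqn (fdiff e)" by simp
  with 1 show ?thesis by simp
qed

lemma ip_jacobi_perturbation_le:
  assumes e: "e \<in> ell 2" and w: "jacobi (\<lambda>n. a n - 1) b (\<lambda>n. c n - 1) e \<in> ell 2"
    and v: "(\<lambda>n. jacobi_v a b c n * (cmod (e n))\<^sup>2) summable_on UNIV"
  shows "cmod (ip (jacobi (\<lambda>n. a n - 1) b (\<lambda>n. c n - 1) e) e)
    \<le> 3 * (\<Sum>\<^sub>\<infinity>n. jacobi_v a b c n * (cmod (e n))\<^sup>2)"
proof -
  let ?W = "jacobi (\<lambda>n. a n - 1) b (\<lambda>n. c n - 1)"
  define g where "g = (\<lambda>n. jacobi_v a b c n * (cmod (e n))\<^sup>2)"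
  define S where "S = infsum g UNIV"
  have g: "(g has_sum S) UNIV"
    using v by (simp add: g_def S_def)
  have gp: "((\<lambda>n. g (n + 1)) has_sum S) UNIV" and gm: "((\<lambda>n. g (n - 1)) has_sum S) UNIV"
    using has_sum_reindex_bij_betw[OF bij_shift[of 1], of g S]
      has_sum_reindex_bij_betw[OF bij_shift[of "-1"], of g S] g by auto
  have "((\<lambda>n. (g (n - 1) + g n) * (1/2) + g n + (g (n + 1) + g n) * (1/2)) has_sum
      ((S + S) * (1/2) + S + (S + S) * (1/2))) UNIV"
    by (intro has_sum_add has_sum_cmult_left g gp gm)
  then have h: "((\<lambda>n. (g (n - 1) + g n) / 2 + g n + (g (n + 1) + g n) / 2) has_sum 3 * S) UNIV"
    by simp
  \<comment> \<open>An off-diagonal coefficient is dominated by the weights at both of its neighbouring sites.\<close>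
  have off: "cmod z * (x * y) \<le> (r * x\<^sup>2 + s * y\<^sup>2) / 2"
    if "cmod z \<le> r" "cmod z \<le> s" "x \<ge> 0" "y \<ge> 0" for z :: complex and x y r s :: real
  proof -
    have "cmod z * (2 * x * y) \<le> cmod z * (x\<^sup>2 + y\<^sup>2)"
      by (intro mult_left_mono sum_squares_bound) auto
    also have "\<dots> \<le> r * x\<^sup>2 + s * y\<^sup>2"
      unfolding distrib_left using that by (intro add_mono mult_right_mono) auto
    finally show ?thesis by simp
  qed
  have "cmod (?W e n * cnj (e n)) \<le> (g (n - 1) + g n) / 2 + g n + (g (n + 1) + g n) / 2" for n
  proof -
    have "cmod (?W e n * cnj (e n)) = cmod ((a (n - 1) - 1) * (e (n - 1) * cnj (e n))
        + b n * (e n * cnj (e n)) + (c n - 1) * (e (n + 1) * cnj (e n)))"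
      by (simp add: jacobi_def algebra_simps)
    also have "\<dots> \<le> cmod (a (n - 1) - 1) * (cmod (e (n - 1)) * cmod (e n))
        + cmod (b n) * (cmod (e n))\<^sup>2 + cmod (c n - 1) * (cmod (e (n + 1)) * cmod (e n))"
      by (intro order_trans[OF norm_triangle_ineq] add_mono) (auto simp: norm_mult power2_eq_square)
    also have "\<dots> \<le> (g (n - 1) + g n) / 2 + g n + (g (n + 1) + g n) / 2"
      unfolding g_def
      using jacobi_v_ge(2)[of a "n - 1" b c] jacobi_v_ge(4)[of c "n + 1" a b]
      by (intro add_mono off mult_right_mono jacobi_v_ge) auto
    finally show ?thesis .
  qed
  then have "norm (ip (?W e) e) \<le> 3 * S"
    by (intro norm_infsum_le[OF ip_has_sum[OF w e] h])
  then show ?thesis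
    by (simp add: S_def g_def)
qed

text \<open>
  In every direction \<open>1 - \<i> \<tau>\<close>, the real part of the form of \<open>J - 2\<close> is dominated by the
  form of a selfadjoint discrete Schroedinger operator with diagonal potential.
\<close>

lemma jacobi_form_le:
  assumes bdd: "bounded (range a)" "bounded (range b)" "bounded (range c)"
    and e: "e \<in> ell 2" and v: "(\<lambda>n. jacobi_v a b c n * (cmod (e n))\<^sup>2) summable_on UNIV"
  defines "q \<equiv> ip (jacobi a b c e) e"
  shows "Re q - 2 * sqn e + \<tau> * Im q \<le> schr_form (\<lambda>n. 3 * (1 + \<bar>\<tau>\<bar>) * jacobi_v a b c n) e"
proof -
  let ?W = "jacobi (\<lambda>n. a n - 1) b (\<lambda>n. c n - 1)"
  define S where "S = (\<Sum>\<^sub>\<infinity>n. jacobi_v a b c n * (cmod (e n))\<^sup>2)"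
  have em: "(\<lambda>n. e (n - 1) + e (n + 1)) \<in> ell 2"
    using ell2_add[OF ell2_shift[OF e, of "-1"] ell2_shift[OF e, of 1]] by (simp add: plus_fun_def)
  have dec: "jacobi a b c e = (\<lambda>n. e (n - 1) + e (n + 1)) + ?W e"
    by (simp add: jacobi_def fun_eq_iff algebra_simps)
  have We: "?W e \<in> ell 2"
    using ell2_diff[OF jacobi_ell2[OF bdd e] em] by (simp add: dec)
  define r where "r = ip (?W e) e"
  have q: "q = of_real (2 * sqn e - sqn (fdiff e)) + r"
    unfolding q_def dec r_def using ip_add_left[OF em We e] ip_free_jacobi[OF e] by simp
  have "cmod r \<le> 3 * S"
    unfolding r_def S_def by (rule ip_jacobi_perturbation_le[OF e We v])
  then have R: "Re r \<le> 3 * S" and I: "\<bar>Im r\<bar> \<le> 3 * S"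
    using abs_Re_le_cmod[of r] abs_Im_le_cmod[of r] by linarith+
  have "\<tau> * Im r \<le> \<bar>\<tau>\<bar> * \<bar>Im r\<bar>"
    by (metis abs_ge_self abs_mult)
  also have "\<dots> \<le> \<bar>\<tau>\<bar> * (3 * S)"
    using I by (intro mult_left_mono) auto
  finally have "Re r + \<tau> * Im r \<le> 3 * (1 + \<bar>\<tau>\<bar>) * S"
    using R by (simp add: algebra_simps)
  moreover have "(\<Sum>\<^sub>\<infinity>n. 3 * (1 + \<bar>\<tau>\<bar>) * jacobi_v a b c n * (cmod (e n))\<^sup>2) = 3 * (1 + \<bar>\<tau>\<bar>) * S"
    by (simp add: S_def mult.assoc infsum_cmult_right')
  ultimately show ?thesis
    by (simp add: schr_form_def q)
qed

section \<open>Distances to the interval and to its endpoints\<close>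

text \<open>The two distances in \<^const>\<open>LT_term\<close>: to \<open>[-2,2]\<close> and to \<open>{-2,2}\<close>.\<close>

definition seg_dist :: "complex \<Rightarrow> real" where
  "seg_dist z = infdist z (complex_of_real ` {-2..2})"

definition end_dist :: "complex \<Rightarrow> real" where
  "end_dist z = infdist z {-2, 2}"

lemma LT_term_eq:
  "LT_term p f z = seg_dist z powr p / cmod (z\<^sup>2 - 4) powr (1/2) * f (- ln (seg_dist z / end_dist z))"
  by (simp add: LT_term_def seg_dist_def end_dist_def Let_def)

lemma end_dist_eq: "end_dist z = min (cmod (z + 2)) (cmod (z - 2))"
  unfolding end_dist_def using infdist_Un_min[of "{-2}" "{2}" z] by (simp add: dist_norm insert_commute)

lemma seg_dist_nonneg: "0 \<le> seg_dist z"
  by (simp add: seg_dist_def infdist_nonneg)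

lemma seg_dist_le_end_dist: "seg_dist z \<le> end_dist z"
  unfolding seg_dist_def end_dist_def
  by (rule infdist_mono) (auto intro: image_eqI[of _ _ "-2"] image_eqI[of _ _ 2])

lemma seg_dist_le:
  assumes "x \<in> {-2..2}"
  shows "seg_dist z \<le> \<bar>Re z - x\<bar> + \<bar>Im z\<bar>"
proof -
  have "seg_dist z \<le> cmod (z - of_real x)"
    unfolding seg_dist_def using infdist_le[of "of_real x" _ z] assms by (auto simp: dist_norm)
  then show ?thesis
    using cmod_le[of "z - of_real x"] by simp
qed

lemma seg_dist_uminus: "seg_dist (- z) = seg_dist z"
proof -
  have "seg_dist (- w) \<le> (INF x\<in>complex_of_real ` {-2..2}. dist w x)" for w
    unfolding seg_dist_def
  proof (rule cINF_greatest)
    fix x :: complex assume "x \<in> complex_of_real ` {-2..2}"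
    then obtain t where t: "x = of_real t" "t \<in> {-2..2}"
      by auto
    have "infdist (- w) (complex_of_real ` {-2..2}) \<le> dist (- w) (of_real (- t))"
      using t by (intro infdist_le) auto
    also have "\<dots> = dist w x"
      by (simp add: t dist_norm norm_minus_commute)
    finally show "infdist (- w) (complex_of_real ` {-2..2}) \<le> dist w x" .
  qed auto
  then have "seg_dist (- w) \<le> seg_dist w" for w
    by (simp add: seg_dist_def infdist_notempty)
  from this[of z] this[of "- z"] show ?thesis by simp
qed

lemma end_dist_uminus: "end_dist (- z) = end_dist z"
  using norm_minus_cancel[of "z - 2"] norm_minus_cancel[of "z + 2"]
  by (simp add: end_dist_eq min.commute del: norm_minus_cancel)

lemma LT_term_uminus: "LT_term p f (- z) = LT_term p f z"
  by (simp add: LT_term_eq seg_dist_uminus end_dist_uminus)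

text \<open>
  On \<open>[-2,2]\<close> the term is 0 by the convention \<open>0 powr p = 0\<close>, so no information on the location
  of the spectrum is needed.
\<close>

lemma LT_term_nonneg:
  assumes "\<forall>x\<ge>0. f x > 0"
  shows "LT_term p f z \<ge> 0"
proof (cases "seg_dist z = 0")
  case False
  then have "0 < seg_dist z" "seg_dist z \<le> end_dist z"
    using seg_dist_nonneg[of z] seg_dist_le_end_dist[of z] by auto
  then have "0 \<le> - ln (seg_dist z / end_dist z)"
    by simp
  with assms have "0 < f (- ln (seg_dist z / end_dist z))"
    by blast
  then show ?thesis
    unfolding LT_term_eq by (intro mult_nonneg_nonneg) auto
qed (simp add: LT_term_eq)

text \<open>
  In the right half-plane, a point outside \<open>[-2,2]\<close> with
  \<open>dist(z, [-2,2]) \<ge> s dist(z, {-2,2})\<close> lies well inside one of four half-planes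
  \<open>Re z - 2 + \<tau> Im z > 0\<close>: one of the slopes \<open>\<tau> = \<plusminus>1\<close> serves if \<open>Re z \<ge> 2\<close>, one of
  \<open>\<tau> = \<plusminus>2/s\<close> otherwise. The estimate uses the sum over all four.
\<close>

lemma seg_dist_powr_le:
  assumes z: "Re z \<ge> 0" and s: "0 < s" "s \<le> 1" "s * end_dist z \<le> seg_dist z" and g: "\<gamma> \<ge> 0"
  defines "M \<equiv> \<lambda>\<tau>. max 0 (Re z - 2 + \<tau> * Im z) powr \<gamma>"
  shows "seg_dist z powr \<gamma> \<le> M 1 + M (-1) + s powr \<gamma> * M (2 / s) + s powr \<gamma> * M (- 2 / s)"
proof -
  have M0: "M \<tau> \<ge> 0" for \<tau>
    by (simp add: M_def)
  have sM0: "s powr \<gamma> * M \<tau> \<ge> 0" for \<tau>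
    using M0 by simp
  obtain \<sigma> :: real where \<sigma>: "\<sigma> = 1 \<or> \<sigma> = - 1" "\<bar>Im z\<bar> = \<sigma> * Im z"
    by (cases "Im z \<ge> 0") (auto intro: that[of 1] that[of "-1"])
  show ?thesis
  proof (cases "Re z \<ge> 2")
    case True
    have "seg_dist z \<le> max 0 (Re z - 2 + \<sigma> * Im z)"
      using seg_dist_le[of 2 z] True \<sigma>(2) by auto
    then have "seg_dist z powr \<gamma> \<le> M \<sigma>"
      unfolding M_def using g seg_dist_nonneg by (intro powr_mono2) auto
    then show ?thesis
      using \<sigma>(1) M0[of 1] M0[of "-1"] sM0[of "2/s"] sM0[of "-2/s"] by auto
  next
    case False
    have d: "seg_dist z \<le> \<bar>Im z\<bar>"
      using seg_dist_le[of "Re z" z] z False by auto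
    have "2 - Re z \<le> end_dist z"
      using complex_Re_le_cmod[of "z + 2"] abs_Re_le_cmod[of "z - 2"] z
      unfolding end_dist_eq by auto
    then have "s * (2 - Re z) \<le> seg_dist z"
      using s mult_left_mono[of "2 - Re z" "end_dist z" s] by linarith
    then have "seg_dist z \<le> 2 * \<bar>Im z\<bar> + s * (Re z - 2)"
      using d by (simp add: algebra_simps)
    also have "\<dots> = s * (Re z - 2 + \<sigma> * 2 / s * Im z)"
      using s(1) unfolding \<sigma>(2) by (simp add: field_simps)
    also have "\<dots> \<le> s * max 0 (Re z - 2 + \<sigma> * 2 / s * Im z)"
      using s(1) by (intro mult_left_mono) auto
    finally have "seg_dist z powr \<gamma> \<le> (s * max 0 (Re z - 2 + \<sigma> * 2 / s * Im z)) powr \<gamma>"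
      using g seg_dist_nonneg by (intro powr_mono2) auto
    also have "\<dots> = s powr \<gamma> * M (\<sigma> * 2 / s)"
      using s(1) by (simp add: M_def powr_mult)
    finally have "seg_dist z powr \<gamma> \<le> s powr \<gamma> * M (\<sigma> * 2 / s)" .
    moreover have "\<sigma> * 2 / s = 2 / s \<or> \<sigma> * 2 / s = - 2 / s"
      using \<sigma>(1) by auto
    ultimately show ?thesis
      using M0[of 1] M0[of "-1"] sM0[of "2/s"] sM0[of "-2/s"] by auto
  qed
qed

text \<open>
  With \<open>d\<close>, \<open>r\<close> the two distances, \<open>r \<le> \<bar>z - 2\<bar> \<le> \<bar>z\<^sup>2 - 4\<bar>\<close> in the right half-plane, so the
  weight \<open>d powr p / \<bar>z\<^sup>2 - 4\<bar> powr (1/2)\<close> is at most \<open>d powr (p - 1/2) * (d / r) powr (1/2)\<close>,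
  and \<open>d / r\<close> lies between \<open>exp (-(k + 1))\<close> and \<open>exp (-k)\<close>.
\<close>

lemma LT_term_le:
  assumes z: "Re z \<ge> 0" "seg_dist z > 0" and f: "antimono_on {0..} f" "\<forall>x\<ge>0. f x > 0"
  defines "k \<equiv> nat \<lfloor>- ln (seg_dist z / end_dist z)\<rfloor>"
  shows "LT_term p f z \<le> seg_dist z powr (p - 1/2) * (exp (- real k / 2) * f k)"
    and "exp (- (real k + 1)) * end_dist z \<le> seg_dist z"
proof -
  define d r where "d = seg_dist z" and "r = end_dist z"
  have d: "d > 0" "d \<le> r" and r: "r > 0"
    using z(2) seg_dist_le_end_dist[of z] by (auto simp: d_def r_def)
  have L: "0 \<le> - ln (d / r)"
    using d by simp
  then have k: "real k \<le> - ln (d / r)" "- ln (d / r) < real k + 1"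
    unfolding k_def d_def[symmetric] r_def[symmetric] by linarith+
  have s: "d / r \<le> exp (- real k)" "exp (- (real k + 1)) \<le> d / r"
    using k d r exp_le_cancel_iff[of "ln (d / r)"] exp_le_cancel_iff[of _ "ln (d / r)"]
    by (simp_all del: exp_le_cancel_iff add: exp_ln)
  then show "exp (- (real k + 1)) * end_dist z \<le> seg_dist z"
    using r by (simp add: d_def r_def field_simps)
  have "r \<le> cmod (z - 2) * 1"
    by (simp add: r_def end_dist_eq)
  also have "\<dots> \<le> cmod (z - 2) * cmod (z + 2)"
    using complex_Re_le_cmod[of "z + 2"] z(1) by (intro mult_left_mono) auto
  also have "\<dots> = cmod (z\<^sup>2 - 4)"
    unfolding norm_mult[symmetric] by (simp add: power2_eq_square algebra_simps)
  finally have den: "r powr (1/2) \<le> cmod (z\<^sup>2 - 4) powr (1/2)"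
    using r by (intro powr_mono2) auto
  have "d powr p / cmod (z\<^sup>2 - 4) powr (1/2) \<le> d powr p / r powr (1/2)"
    using den r by (intro divide_left_mono mult_pos_pos) (auto intro: less_le_trans)
  also have "\<dots> = d powr (p - 1/2) * (d / r) powr (1/2)"
    using d r by (simp add: powr_divide powr_diff)
  also have "\<dots> \<le> d powr (p - 1/2) * exp (- real k) powr (1/2)"
    using s d r by (intro mult_left_mono powr_mono2) auto
  also have "exp (- real k) powr (1/2) = exp (- real k / 2)"
    by (simp add: powr_def)
  finally have 1: "d powr p / cmod (z\<^sup>2 - 4) powr (1/2) \<le> d powr (p - 1/2) * exp (- real k / 2)" .
  have "f (- ln (d / r)) \<le> f k"
    using f(1) k L by (auto simp: monotone_on_def)
  with 1 have "d powr p / cmod (z\<^sup>2 - 4) powr (1/2) * f (- ln (d / r))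
      \<le> d powr (p - 1/2) * exp (- real k / 2) * f k"
    using f(2) L by (intro mult_mono) (auto intro: less_imp_le)
  then show "LT_term p f z \<le> seg_dist z powr (p - 1/2) * (exp (- real k / 2) * f k)"
    by (simp add: LT_term_eq d_def r_def mult.assoc)
qed

lemma sum_le_integral:
  fixes f :: "real \<Rightarrow> real"
  assumes cont: "continuous_on {0..} f" and anti: "antimono_on {0..} f" and pos: "\<forall>x\<ge>0. f x > 0"
    and int: "f integrable_on {0..}"
  shows "(\<Sum>k\<le>N. f (real k)) \<le> integral {0..} f + f 0"
proof -
  have I: "f integrable_on {x..y}" if "0 \<le> x" for x y
    by (intro integrable_continuous_interval continuous_on_subset[OF cont]) (use that in auto)
  have "(\<Sum>k\<le>N. f (real k)) \<le> integral {0..real N} f + f 0"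
  proof (induction N)
    case (Suc N)
    have "f (real (Suc N)) = integral {real N..real (Suc N)} (\<lambda>_. f (real (Suc N)))"
      by simp
    also have "\<dots> \<le> integral {real N..real (Suc N)} f"
      using anti by (intro integral_le I) (auto simp: monotone_on_def)
    finally have "f (real (Suc N)) \<le> integral {real N..real (Suc N)} f" .
    moreover have "integral {0..real N} f + integral {real N..real (Suc N)} f
        = integral {0..real (Suc N)} f"
      by (intro Henstock_Kurzweil_Integration.integral_combine I) auto
    ultimately show ?case
      using Suc.IH by simp
  qed simp
  also have "integral {0..real N} f \<le> integral {0..} f"
    using pos by (intro integral_subset_le I int) (auto intro: less_imp_le)
  finally show ?thesis by simp
qed

section \<open>Summation over the discrete spectrum\<close>

lemma ell_jacobi_v:
  assumes "p > 0"
  shows "jacobi_v a b c \<in> ell p \<longleftrightarrow> (\<lambda>n. jacobi_v a b c n powr p) summable_on UNIV"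
    and "ell_norm p (jacobi_v a b c) powr p = (\<Sum>\<^sub>\<infinity>n. jacobi_v a b c n powr p)"
proof -
  have "0 \<le> (\<Sum>\<^sub>\<infinity>n. jacobi_v a b c n powr p)"
    by (intro infsum_nonneg) auto
  then show "jacobi_v a b c \<in> ell p \<longleftrightarrow> (\<lambda>n. jacobi_v a b c n powr p) summable_on UNIV"
    and "ell_norm p (jacobi_v a b c) powr p = (\<Sum>\<^sub>\<infinity>n. jacobi_v a b c n powr p)"
    using assms by (simp_all add: ell_def ell_norm_def powr_powr jacobi_v_nonneg)
qed

text \<open>
  The unitary multiplication by \<open>(-1) ^ n\<close>. It turns \<open>J\<close> into the negative of the Jacobi operator
  with \<open>b\<close> replaced by \<open>-b\<close>, which exchanges the left and the right half-plane.
\<close>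

definition flip :: "(int \<Rightarrow> complex) \<Rightarrow> (int \<Rightarrow> complex)" where
  "flip u = (\<lambda>n. if even n then u n else - u n)"

lemma flip_flip [simp]: "flip (flip u) = u"
  by (auto simp: flip_def)

lemma flip_ell2: "u \<in> ell 2 \<Longrightarrow> flip u \<in> ell 2"
  by (rule ell2_dominated[where K = 1]) (auto simp: flip_def)

lemma ip_flip: "ip (flip u) (flip w) = ip u w"
  unfolding ip_def by (rule infsum_cong) (auto simp: flip_def)

lemma orthonormal_flip:
  assumes "orthonormal E"
  shows "orthonormal (flip ` E)"
proof -
  have inj: "flip x = flip y \<longleftrightarrow> x = y" for x y
    by (metis flip_flip)
  show ?thesis
    using assms by (auto simp: orthonormal_def flip_ell2 ip_flip inj)
qed

lemma ip_jacobi_flip: "ip (jacobi a (\<lambda>n. - b n) c (flip u)) (flip u) = - ip (jacobi a b c u) u"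
proof -
  have "jacobi a (\<lambda>n. - b n) c (flip u) = cscale (-1) (flip (jacobi a b c u))"
    by (auto simp: jacobi_def flip_def cscale_def fun_eq_iff)
  then have "ip (jacobi a (\<lambda>n. - b n) c (flip u)) (flip u) = -1 * ip (jacobi a b c u) u"
    by (simp only: ip_cscale_left ip_flip)
  then show ?thesis
    by simp
qed

lemma jacobi_v_flip: "jacobi_v a (\<lambda>n. - b n) c = jacobi_v a b c"
  by (simp add: jacobi_v_def fun_eq_iff)

text \<open>
  A constant for the Lieb--Thirring inequality for orthonormal sets; it depends on \<open>p\<close> alone.
\<close>

definition lt_const :: "real \<Rightarrow> real" where
  "lt_const p = (SOME K. K > 0 \<and> (\<forall>E V. orthonormal E \<longrightarrow> (\<forall>n. 0 \<le> V n) \<longrightarrow>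
    (\<lambda>n. V n powr p) summable_on UNIV \<longrightarrow>
    (\<Sum>e\<in>E. max 0 (schr_form V e) powr (p - 1/2)) \<le> K * (\<Sum>\<^sub>\<infinity>n. V n powr p)))"

lemma lt_const:
  assumes "p \<ge> 3/2"
  shows "lt_const p > 0"
    and "orthonormal E \<Longrightarrow> (\<And>n. 0 \<le> V n) \<Longrightarrow> (\<lambda>n. V n powr p) summable_on UNIV \<Longrightarrow>
      (\<Sum>e\<in>E. max 0 (schr_form V e) powr (p - 1/2)) \<le> lt_const p * (\<Sum>\<^sub>\<infinity>n. V n powr p)"
  using someI_ex[OF lieb_thirring_orthonormal[OF assms]] unfolding lt_const_def[symmetric] by auto

context
  fixes a b c :: "int \<Rightarrow> complex" and p :: real
  assumes p: "p \<ge> 3/2"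
    and bdd: "bounded (range a)" "bounded (range b)" "bounded (range c)"
    and v: "(\<lambda>n. jacobi_v a b c n powr p) summable_on UNIV"
begin

abbreviation (input) qform where "qform e \<equiv> ip (jacobi a b c e) e"

abbreviation (input) vsum where "vsum \<equiv> \<Sum>\<^sub>\<infinity>n. jacobi_v a b c n powr p"

lemma vsum_nonneg: "0 \<le> vsum"
  by (intro infsum_nonneg) auto

lemma half_plane_sum_le:
  assumes E: "orthonormal E"
  shows "(\<Sum>e\<in>E. max 0 (Re (qform e) - 2 + \<tau> * Im (qform e)) powr (p - 1/2))
    \<le> lt_const p * (3 * (1 + \<bar>\<tau>\<bar>)) powr p * vsum"
proof -
  let ?V = "\<lambda>n. 3 * (1 + \<bar>\<tau>\<bar>) * jacobi_v a b c n"
  have V: "?V n powr p = (3 * (1 + \<bar>\<tau>\<bar>)) powr p * jacobi_v a b c n powr p" for n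
    by (simp add: powr_mult jacobi_v_nonneg)
  have "p > 0"
    using p by simp
  then obtain M where M: "\<And>n. jacobi_v a b c n \<le> M"
    using powr_summable_bounded[OF jacobi_v_nonneg v] by blast
  have "(\<Sum>e\<in>E. max 0 (Re (qform e) - 2 + \<tau> * Im (qform e)) powr (p - 1/2))
      \<le> (\<Sum>e\<in>E. max 0 (schr_form ?V e) powr (p - 1/2))"
  proof (intro sum_mono powr_mono2 max.mono)
    fix e assume "e \<in> E"
    then have "e \<in> ell 2" "sqn e = 1"
      using E orthonormal_sqn by (auto simp: orthonormal_def)
    then show "Re (qform e) - 2 + \<tau> * Im (qform e) \<le> schr_form ?V e"
      using jacobi_form_le[OF bdd _ summable_bounded_mult[OF jacobi_v_nonneg M], of e \<tau>] by simp
  qed (use p in auto)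
  also have "\<dots> \<le> lt_const p * (\<Sum>\<^sub>\<infinity>n. ?V n powr p)"
    unfolding V by (rule lt_const(2)[OF p E, of ?V, unfolded V])
      (auto simp: jacobi_v_nonneg intro!: summable_on_cmult_right v)
  also have "(\<Sum>\<^sub>\<infinity>n. ?V n powr p) = (3 * (1 + \<bar>\<tau>\<bar>)) powr p * vsum"
    by (simp only: V infsum_cmult_right')
  finally show ?thesis by (simp add: mult.assoc)
qed

text \<open>
  The half-planes of slope \<open>\<plusminus>2/s\<close> contribute \<open>s powr (p - 1/2)\<close> times a multiple of
  \<open>(1/s) powr p\<close>; the resulting power \<open>s powr (-1/2)\<close> is exactly compensated by the weight
  \<open>(d / r) powr (1/2)\<close> in \<open>LT_term_le\<close>.
\<close>

lemma sector_sum_le: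
  assumes E: "orthonormal E" and s: "0 < s" "s \<le> 1"
    and sec: "\<And>e. e \<in> E \<Longrightarrow> Re (qform e) \<ge> 0" "\<And>e. e \<in> E \<Longrightarrow> s * end_dist (qform e) \<le> seg_dist (qform e)"
  shows "(\<Sum>e\<in>E. seg_dist (qform e) powr (p - 1/2)) \<le> 4 * lt_const p * 9 powr p * s powr (-1/2) * vsum"
proof -
  define M where "M = (\<lambda>\<tau>. \<Sum>e\<in>E. max 0 (Re (qform e) - 2 + \<tau> * Im (qform e)) powr (p - 1/2))"
  define B where "B = lt_const p * 9 powr p * s powr (-1/2) * vsum"
  have L: "lt_const p \<ge> 0"
    using lt_const(1)[OF p] by simp
  have "M \<tau> \<le> B" if "\<bar>\<tau>\<bar> = 1" for \<tau>
  proof -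
    have "M \<tau> \<le> lt_const p * 6 powr p * vsum"
      unfolding M_def using half_plane_sum_le[OF E, of \<tau>] that by simp
    also have "6 powr p \<le> 9 powr p * s powr (-1/2)"
    proof -
      have "(6::real) powr p * 1 \<le> 9 powr p * s powr (-1/2)"
        using p s powr_mono2'[of "-1/2" s 1] by (intro mult_mono powr_mono2) auto
      then show ?thesis by simp
    qed
    finally show ?thesis
      using L vsum_nonneg by (simp add: B_def mult.assoc mult_left_mono mult_right_mono)
  qed
  then have B1: "M 1 \<le> B" "M (-1) \<le> B"
    by auto
  have B2: "s powr (p - 1/2) * M \<tau> \<le> B" if "\<bar>\<tau>\<bar> = 2 / s" for \<tau>
  proof -
    have "M \<tau> \<le> lt_const p * (3 * (1 + 2 / s)) powr p * vsum"
      unfolding M_def using half_plane_sum_le[OF E, of \<tau>] that by simp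
    also have "(3 * (1 + 2 / s)) powr p \<le> (9 / s) powr p"
      using p s by (intro powr_mono2) (auto simp: field_simps)
    finally have "M \<tau> \<le> lt_const p * (9 / s) powr p * vsum"
      using L vsum_nonneg by (simp add: mult_left_mono mult_right_mono)
    then have "s powr (p - 1/2) * M \<tau> \<le> s powr (p - 1/2) * (lt_const p * (9 / s) powr p * vsum)"
      by (intro mult_left_mono) auto
    also have "\<dots> = lt_const p * 9 powr p * (s powr (p - 1/2) / s powr p) * vsum"
      using s by (simp add: powr_divide)
    also have "s powr (p - 1/2) / s powr p = s powr (-1/2)"
      by (simp flip: powr_diff)
    finally show ?thesis by (simp add: B_def)
  qed
  have "(\<Sum>e\<in>E. seg_dist (qform e) powr (p - 1/2))
      \<le> M 1 + M (-1) + s powr (p - 1/2) * M (2 / s) + s powr (p - 1/2) * M (- 2 / s)"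
    unfolding M_def sum_distrib_left sum.distrib[symmetric]
    using p s sec by (intro sum_mono seg_dist_powr_le) auto
  also have "\<dots> \<le> B + B + B + B"
    using B1 B2 s by (intro add_mono) auto
  finally show ?thesis
    by (simp add: B_def)
qed

text \<open>
  The eigenvalues in the right half-plane are split according to the integer part \<open>k\<close> of the
  argument of \<open>f\<close>; the sector bound with aperture \<open>s = exp (-(k + 1))\<close> controls each part by a
  multiple of \<open>f k\<close>.
\<close>

lemma LT_sum_right_le:
  fixes f :: "real \<Rightarrow> real"
  assumes E: "orthonormal E"
    and f: "continuous_on {0..} f" "antimono_on {0..} f" "\<forall>x\<ge>0. f x > 0" "f integrable_on {0..}"
  shows "(\<Sum>e\<in>{e\<in>E. Re (qform e) \<ge> 0}. LT_term p f (qform e))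
    \<le> 4 * lt_const p * 9 powr p * exp (1/2) * (integral {0..} f + f 0) * vsum"
proof -
  define F where "F = {e\<in>E. Re (qform e) \<ge> 0 \<and> seg_dist (qform e) > 0}"
  define k where "k = (\<lambda>e. nat \<lfloor>- ln (seg_dist (qform e) / end_dist (qform e))\<rfloor>)"
  define A where "A = 4 * lt_const p * 9 powr p"
  have A: "A \<ge> 0"
    using lt_const(1)[OF p] by (simp add: A_def)
  have fin: "finite E" "finite F"
    using E by (auto simp: orthonormal_def F_def)
  obtain N where N: "k ` F \<subseteq> {..N}"
    using fin finite_nat_iff_bounded_le by blast
  have zero: "LT_term p f z = 0" if "seg_dist z = 0" for z
    using that p by (simp add: LT_term_eq)
  have "(\<Sum>e\<in>{e\<in>E. Re (qform e) \<ge> 0}. LT_term p f (qform e)) = (\<Sum>e\<in>F. LT_term p f (qform e))"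
    using fin seg_dist_nonneg zero
    by (intro sum.mono_neutral_right) (auto simp: F_def less_le)
  also have "\<dots> = (\<Sum>j\<le>N. \<Sum>e\<in>{e\<in>F. k e = j}. LT_term p f (qform e))"
    using fin N by (intro sum.group[symmetric]) auto
  also have "\<dots> \<le> (\<Sum>j\<le>N. A * exp (1/2) * f j * vsum)"
  proof (rule sum_mono)
    fix j
    let ?G = "{e\<in>F. k e = j}"
    have fj: "f j \<ge> 0"
      using f(3) by (auto intro: less_imp_le)
    have "(\<Sum>e\<in>?G. LT_term p f (qform e)) \<le> (\<Sum>e\<in>?G. seg_dist (qform e) powr (p - 1/2) * (exp (- real j / 2) * f j))"
      using LT_term_le(1)[OF _ _ f(2,3)] by (intro sum_mono) (auto simp: F_def k_def)
    also have "\<dots> = (\<Sum>e\<in>?G. seg_dist (qform e) powr (p - 1/2)) * (exp (- real j / 2) * f j)"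
      by (simp add: sum_distrib_right)
    also have "\<dots> \<le> (A * exp (- (real j + 1)) powr (-1/2) * vsum) * (exp (- real j / 2) * f j)"
      unfolding A_def
    proof (intro mult_right_mono sector_sum_le)
      show "orthonormal ?G"
        using E by (rule orthonormal_subset) (auto simp: F_def)
      show "exp (- (real j + 1)) * end_dist (qform e) \<le> seg_dist (qform e)" if "e \<in> ?G" for e
        using LT_term_le(2)[OF _ _ f(2,3), of "qform e"] that by (auto simp: F_def k_def)
    qed (use fj in \<open>auto simp: F_def\<close>)
    also have "exp (- (real j + 1)) powr (-1/2) = exp ((real j + 1) / 2)"
      by (simp add: powr_def field_simps)
    also have "A * exp ((real j + 1) / 2) * vsum * (exp (- real j / 2) * f j)
        = A * (exp ((real j + 1) / 2) * exp (- real j / 2)) * f j * vsum"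
      by (simp only: mult_ac)
    also have "exp ((real j + 1) / 2) * exp (- real j / 2) = exp (1/2)"
      by (simp add: exp_add[symmetric] add_divide_distrib)
    finally show "(\<Sum>e\<in>?G. LT_term p f (qform e)) \<le> A * exp (1/2) * f j * vsum" .
  qed
  also have "\<dots> = A * exp (1/2) * (\<Sum>j\<le>N. f j) * vsum"
    by (simp add: sum_distrib_left sum_distrib_right)
  also have "\<dots> \<le> A * exp (1/2) * (integral {0..} f + f 0) * vsum"
    using sum_le_integral[OF f] A vsum_nonneg by (intro mult_right_mono mult_left_mono) auto
  finally show ?thesis by (simp add: A_def)
qed

end

lemma LT_sum_orthonormal_le:
  fixes f :: "real \<Rightarrow> real"
  assumes p: "p \<ge> 3/2" and bdd: "bounded (range a)" "bounded (range b)" "bounded (range c)"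
    and v: "(\<lambda>n. jacobi_v a b c n powr p) summable_on UNIV" and E: "orthonormal E"
    and f: "continuous_on {0..} f" "antimono_on {0..} f" "\<forall>x\<ge>0. f x > 0" "f integrable_on {0..}"
  shows "(\<Sum>e\<in>E. LT_term p f (ip (jacobi a b c e) e))
    \<le> 8 * lt_const p * 9 powr p * exp (1/2) * (integral {0..} f + f 0)
      * (\<Sum>\<^sub>\<infinity>n. jacobi_v a b c n powr p)"
proof -
  let ?q = "\<lambda>e. ip (jacobi a b c e) e"
  let ?q' = "\<lambda>e. ip (jacobi a (\<lambda>n. - b n) c e) e"
  let ?B = "4 * lt_const p * 9 powr p * exp (1/2) * (integral {0..} f + f 0)
      * (\<Sum>\<^sub>\<infinity>n. jacobi_v a b c n powr p)"
  have fin: "finite E"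
    using E by (simp add: orthonormal_def)
  have "range (\<lambda>n. - b n) = uminus ` range b"
    by auto
  then have bdd': "bounded (range (\<lambda>n. - b n))"
    using bdd(2) by simp
  have right: "(\<Sum>e\<in>{e\<in>E. Re (?q e) \<ge> 0}. LT_term p f (?q e)) \<le> ?B"
    by (rule LT_sum_right_le[OF p bdd v E f])
  have "(\<Sum>e\<in>{e\<in>flip ` E. Re (?q' e) \<ge> 0}. LT_term p f (?q' e)) \<le> ?B"
    using LT_sum_right_le[OF p bdd(1) bdd' bdd(3) _ orthonormal_flip[OF E] f] v
    by (simp add: jacobi_v_flip)
  also have "{e\<in>flip ` E. Re (?q' e) \<ge> 0} = flip ` {e\<in>E. Re (?q e) \<le> 0}"
    by (auto simp: ip_jacobi_flip)
  also have "(\<Sum>e\<in>flip ` {e\<in>E. Re (?q e) \<le> 0}. LT_term p f (?q' e))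
      = (\<Sum>e\<in>{e\<in>E. Re (?q e) \<le> 0}. LT_term p f (?q e))"
    by (subst sum.reindex) (auto simp: ip_jacobi_flip LT_term_uminus intro: inj_on_inverseI[of _ flip])
  finally have left: "(\<Sum>e\<in>{e\<in>E. Re (?q e) \<le> 0}. LT_term p f (?q e)) \<le> ?B" .
  have "(\<Sum>e\<in>{e\<in>E. Re (?q e) \<ge> 0} \<union> {e\<in>E. Re (?q e) < 0}. LT_term p f (?q e))
      = (\<Sum>e\<in>{e\<in>E. Re (?q e) \<ge> 0}. LT_term p f (?q e))
        + (\<Sum>e\<in>{e\<in>E. Re (?q e) < 0}. LT_term p f (?q e))"
    using fin by (intro sum.union_disjoint) auto
  also have "{e\<in>E. Re (?q e) \<ge> 0} \<union> {e\<in>E. Re (?q e) < 0} = E"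
    by auto
  finally have split: "(\<Sum>e\<in>E. LT_term p f (?q e))
      = (\<Sum>e\<in>{e\<in>E. Re (?q e) \<ge> 0}. LT_term p f (?q e))
        + (\<Sum>e\<in>{e\<in>E. Re (?q e) < 0}. LT_term p f (?q e))" .
  have "(\<Sum>e\<in>{e\<in>E. Re (?q e) < 0}. LT_term p f (?q e))
      \<le> (\<Sum>e\<in>{e\<in>E. Re (?q e) \<le> 0}. LT_term p f (?q e))"
    using fin LT_term_nonneg[OF f(3)] by (intro sum_mono2) auto
  then show ?thesis
    using left right split by simp
qed

lemma LT_sum_finite_le:
  fixes f :: "real \<Rightarrow> real"
  assumes p: "p \<ge> 3/2" and bdd: "bounded (range a)" "bounded (range b)" "bounded (range c)"
    and v: "(\<lambda>n. jacobi_v a b c n powr p) summable_on UNIV" and F: "finite F"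
    and f: "continuous_on {0..} f" "antimono_on {0..} f" "\<forall>x\<ge>0. f x > 0" "f integrable_on {0..}"
  shows "(\<Sum>z\<in>F. real (alg_mult (jacobi a b c) z) * LT_term p f z)
    \<le> 8 * lt_const p * 9 powr p * exp (1/2) * (integral {0..} f + f 0)
      * (\<Sum>\<^sub>\<infinity>n. jacobi_v a b c n powr p)"
proof -
  interpret ell2_operator "jacobi a b c"
    by (rule ell2_operator_jacobi[OF bdd])
  let ?q = "\<lambda>e. ip (jacobi a b c e) e"
  obtain E where E: "orthonormal E"
    and mult: "\<And>z. z \<in> F \<Longrightarrow> alg_mult (jacobi a b c) z \<le> card {e\<in>E. ?q e = z}"
    using exists_schur_family[OF F] by blast
  have fin: "finite E"
    using E by (simp add: orthonormal_def)
  have "(\<Sum>z\<in>F. real (alg_mult (jacobi a b c) z) * LT_term p f z)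
      \<le> (\<Sum>z\<in>F. real (card {e\<in>E. ?q e = z}) * LT_term p f z)"
    using mult LT_term_nonneg[OF f(3)] by (intro sum_mono mult_right_mono) auto
  also have "\<dots> = (\<Sum>z\<in>F. \<Sum>e\<in>{e\<in>{e\<in>E. ?q e \<in> F}. ?q e = z}. LT_term p f (?q e))"
    by (intro sum.cong refl) (auto intro!: arg_cong2[of _ _ _ _ "(*)"] arg_cong[of _ _ card])
  also have "\<dots> = (\<Sum>e\<in>{e\<in>E. ?q e \<in> F}. LT_term p f (?q e))"
    using fin F by (intro sum.group) auto
  also have "\<dots> \<le> (\<Sum>e\<in>E. LT_term p f (?q e))"
    using fin LT_term_nonneg[OF f(3)] by (intro sum_mono2) auto
  also have "\<dots> \<le> 8 * lt_const p * 9 powr p * exp (1/2) * (integral {0..} f + f 0)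
      * (\<Sum>\<^sub>\<infinity>n. jacobi_v a b c n powr p)"
    by (rule LT_sum_orthonormal_le[OF p bdd v E f])
  finally show ?thesis .
qed

theorem theorem3p1:
  fixes p :: real
  assumes "p \<ge> 3 / 2"
  shows "\<exists>Cp>0. \<forall>f :: real \<Rightarrow> real.
    continuous_on {0..} f \<longrightarrow> antimono_on {0..} f \<longrightarrow> (\<forall>x\<ge>0. f x > 0) \<longrightarrow>
    f integrable_on {0..} \<longrightarrow>
    (\<exists>Cpf>0. Cpf = Cp * (integral {0..} f + f 0) \<and>
      (\<forall>a b c :: int \<Rightarrow> complex.
        bounded (range a) \<longrightarrow> bounded (range b) \<longrightarrow> bounded (range c) \<longrightarrow>
        jacobi_v a b c \<in> ell p \<longrightarrow>
        (\<lambda>z. real (alg_mult (jacobi a b c) z) * LT_term p f z)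
          summable_on discrete_spectrum (jacobi a b c) \<and>
        (\<Sum>\<^sub>\<infinity>z\<in>discrete_spectrum (jacobi a b c).
            real (alg_mult (jacobi a b c) z) * LT_term p f z)
          \<le> Cpf * ell_norm p (jacobi_v a b c) powr p))"
proof -
  define Cp where "Cp = 8 * lt_const p * 9 powr p * exp (1/2)"
  have Cp: "Cp > 0"
    using lt_const(1)[OF assms] by (simp add: Cp_def)
  have p0: "p > 0"
    using assms by simp
  show ?thesis
  proof (rule exI[of _ Cp], intro conjI allI impI Cp)
    fix f :: "real \<Rightarrow> real"
    assume f: "continuous_on {0..} f" "antimono_on {0..} f" "\<forall>x\<ge>0. f x > 0" "f integrable_on {0..}"
    have "integral {0..} f \<ge> 0"
      using f(3) by (intro Henstock_Kurzweil_Integration.integral_nonneg f(4)) (auto intro: less_imp_le)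
    then have I: "integral {0..} f + f 0 > 0"
      using f(3) by (intro add_nonneg_pos) auto
    have main: "(\<lambda>z. real (alg_mult (jacobi a b c) z) * LT_term p f z)
          summable_on discrete_spectrum (jacobi a b c) \<and>
        (\<Sum>\<^sub>\<infinity>z\<in>discrete_spectrum (jacobi a b c).
            real (alg_mult (jacobi a b c) z) * LT_term p f z)
          \<le> Cp * (integral {0..} f + f 0) * ell_norm p (jacobi_v a b c) powr p"
      if bdd: "bounded (range a)" "bounded (range b)" "bounded (range c)"
        and v: "jacobi_v a b c \<in> ell p" for a b c :: "int \<Rightarrow> complex"
    proof -
      let ?g = "\<lambda>z. real (alg_mult (jacobi a b c) z) * LT_term p f z"
      have le: "sum ?g F \<le> Cp * (integral {0..} f + f 0) * ell_norm p (jacobi_v a b c) powr p"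
        if "finite F" for F
        using LT_sum_finite_le[OF assms bdd _ that f] v
        by (simp add: ell_jacobi_v[OF p0] Cp_def)
      have "?g summable_on discrete_spectrum (jacobi a b c)"
      proof (rule nonneg_bdd_above_summable_on)
        show "bdd_above (sum ?g ` {F. F \<subseteq> discrete_spectrum (jacobi a b c) \<and> finite F})"
          by (rule bdd_aboveI2) (use le in auto)
      qed (use LT_term_nonneg[OF f(3)] in auto)
      then show ?thesis
        using le by (intro conjI infsum_le_finite_sums) auto
    qed
    show "\<exists>Cpf>0. Cpf = Cp * (integral {0..} f + f 0) \<and>
      (\<forall>a b c :: int \<Rightarrow> complex.
        bounded (range a) \<longrightarrow> bounded (range b) \<longrightarrow> bounded (range c) \<longrightarrow>
        jacobi_v a b c \<in> ell p \<longrightarrow>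
        (\<lambda>z. real (alg_mult (jacobi a b c) z) * LT_term p f z)
          summable_on discrete_spectrum (jacobi a b c) \<and>
        (\<Sum>\<^sub>\<infinity>z\<in>discrete_spectrum (jacobi a b c).
            real (alg_mult (jacobi a b c) z) * LT_term p f z)
          \<le> Cpf * ell_norm p (jacobi_v a b c) powr p)"
      using main Cp I by (intro exI[of _ "Cp * (integral {0..} f + f 0)"]) auto
  qed
qed

end
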